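(* Fix $d\in\{2,3\}$, $L_1,\dots,L_d>0$, $\alpha>0$, $\widehat C_{\rm exc}>0$, $\theta\in\{1,\tfrac12\}$. Consider any family of periodic grids (with $N_\ell$ points in direction $\ell$), time steps $k>0$ and nodal vectors $\bm m_i\in\mathbb R^3$, and set $h:=\min_{1\le\ell\le d}L_\ell/N_\ell$. Assume that $$\frac{k}{h^2}\le C_0$$ for a constant $C_0$ independent of $k$ and $h$, that $0<m_-\le\|\bm m_i\|_2\le m_+$ uniformly over the family, and that $\lambda>0$ is fixed independently of $k$ and $h$. Define $$\beta_0=\alpha+\theta\widehat C_{\rm exc}d\pi^2C_0,\qquad q_0=\max\left\{\left|\frac{\lambda-\alpha}{\lambda+\alpha}\right|,\left|\frac{\lambda-\beta_0}{\lambda+\beta_0}\right|\right\},$$ $$\gamma_0=\min\left\{\frac{2\lambda m_-}{\lambda^2+m_-^2},\frac{2\lambda m_+}{\lambda^2+m_+^2}\right\},\qquad \vartheta_0=\left[1-\frac{(1-q_0^2)\gamma_0^2}{\gamma_0^2+1+q_0^2}\right]^{1/2},\qquad \kappa_0=\left(\frac{\lambda^2+m_+^2}{\lambda^2+m_-^2}\right)^{1/2}.$$ Then $q_0<1$, $\gamma_0>0$, $\vartheta_0<1$; for every member of the family, $q_T(\lambda)\le q_0$, and the residuals $\mathfrak r_j=\mathcal M_\lambda^{-1}(\bm b-\mathcal A\bm x_j)$ of unrestarted left-preconditioned GMRES (with $\mathfrak r_0\ne0$) satisfy, for every integer $j\ge0$, $$\frac{\|\mathfrak r_{2j}\|_2}{\|\mathfrak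 r_0\|_2}\le\kappa_0\vartheta_0^j.$$ Consequently, for any $0<\varepsilon<1$, a residual reduction $\|\mathfrak r\|_2/\|\mathfrak r_0\|_2\le\varepsilon$ is guaranteed after at most $$2\left\lceil\frac{\log(\kappa_0/\varepsilon)}{\log(1/\vartheta_0)}\right\rceil$$ GMRES iterations, a bound that depends only on $C_0$, the physical coefficients ($\alpha,\widehat C_{\rm exc},\theta,d$), $m_\pm$, $\lambda$ and $\varepsilon$, and not on the individual values of $k$ or $h$.
   Context: Grid: a uniform periodic Cartesian grid on $\prod_{\ell=1}^d(0,L_\ell)$ with $N_\ell$ points in direction $\ell$ and $N_g=\prod_\ell N_\ell$ nodes. The discrete Fourier wave vectors $\bm\xi\in\mathcal F_N$ have components $\xi_\ell=2\pi k_\ell/L_\ell$ with integers $k_\ell$, $|k_\ell|\le N_\ell/2$, one set of $N_g$ distinct aliasing representatives. $-\Delta_N$ is the operator on grid functions (applied componentwise to $\mathbb R^3$-valued ones) that multiplies the discrete Fourier coefficient at $\bm\xi$ by $|\bm\xi|^2$. $H\in\mathbb R^{3N_g\times3N_g}$ is the matrix of $\alpha I+\theta k\widehat C_{\rm exc}(-\Delta_N)$ acting on $\mathbb R^3$-valued grid functions (nodal values as unknowns). Given nodal vectors $\bm m_1,\dots,\bm m_{N_g}\in\mathbb R^3$: $S$ is block diagonal with $3\times3$ blocks $\Lambda_i$, $\Lambda_i\bm a=\bm m_i\times\bm a$; $B\in\mathbb R^{N_g\times3N_g}$ is block diagonal with $1\times3$ blocks $\bm m_i^T$; $$\mathcal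 A=\begin{bmatrix}H+S&B^T\\-B&0\end{bmatrix},\quad \mathcal H=\begin{bmatrix}H&0\\0&0\end{bmatrix},\quad\mathcal S=\begin{bmatrix}S&B^T\\-B&0\end{bmatrix},\quad \mathcal M_\lambda=(\lambda\mathcal I+\mathcal H)(\lambda\mathcal I+\mathcal S).$$ Let $Z\in\mathbb R^{3N_g\times2N_g}$ have orthonormal columns spanning $\ker B$, $H_T=Z^THZ$, and $q_T(\lambda)=\max_{\mu\in\sigma(H_T)}\left|\frac{\lambda-\mu}{\lambda+\mu}\right|$. Unrestarted left-preconditioned GMRES for $\mathcal A\bm x=\bm b$ (exact arithmetic, arbitrary $\bm b$ and $\bm x_0$): with $\mathcal P_\lambda=\mathcal M_\lambda^{-1}\mathcal A$, $\bm x_j\in\bm x_0+\mathrm{span}\{\mathfrak r_0,\mathcal P_\lambda\mathfrak r_0,\dots,\mathcal P_\lambda^{j-1}\mathfrak r_0\}$ minimizes $\|\mathcal M_\lambda^{-1}(\bm b-\mathcal A\bm x)\|_2$ over this affine space. *)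

theory Defs
  imports
    "Jordan_Normal_Form.Gauss_Jordan_Elimination"
    "Jordan_Normal_Form.Matrix_Kernel"
    "Jordan_Normal_Form.Spectral_Radius"
    "HOL-Analysis.L2_Norm"
    "HOL-Analysis.Cross3"
begin

unbundle no cross3_syntax

section \<open>Periodic grids and the discrete Laplacian\<close>

definition grid_size :: "nat \<Rightarrow> (nat \<Rightarrow> nat) \<Rightarrow> nat" where
  "grid_size d N = (\<Prod>l<d. N l)"

definition mesh_width :: "nat \<Rightarrow> (nat \<Rightarrow> real) \<Rightarrow> (nat \<Rightarrow> nat) \<Rightarrow> real" where
  "mesh_width d L N = Min ((\<lambda>l. L l / real (N l)) ` {..<d})"

text \<open>The nodes are the multi-indices in \<^term>\<open>PiE {..<d} (\<lambda>l. {..<N l})\<close>; \<open>\<nu> p\<close> is the multi-index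
  of the \<open>p\<close>-th node.  The order in which the nodes are numbered is arbitrary.\<close>

definition node_numbering :: "nat \<Rightarrow> (nat \<Rightarrow> nat) \<Rightarrow> (nat \<Rightarrow> nat \<Rightarrow> nat) \<Rightarrow> bool" where
  "node_numbering d N \<nu> \<longleftrightarrow> bij_betw \<nu> {..<grid_size d N} (PiE {..<d} (\<lambda>l. {..<N l}))"

definition node :: "(nat \<Rightarrow> real) \<Rightarrow> (nat \<Rightarrow> nat) \<Rightarrow> (nat \<Rightarrow> nat \<Rightarrow> nat) \<Rightarrow> nat \<Rightarrow> nat \<Rightarrow> real" where
  "node L N \<nu> p l = real (\<nu> p l) * L l / real (N l)"

text \<open>Wave vectors are given by their integer indices \<open>\<kappa>\<close>.  Two indices are aliases if they agree
  modulo \<open>N l\<close> in every direction; for even \<open>N l\<close> this leaves a choice between \<open>N l / 2\<close>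
  and \<open>- N l / 2\<close>.\<close>

definition wave_vector :: "(nat \<Rightarrow> real) \<Rightarrow> (nat \<Rightarrow> int) \<Rightarrow> nat \<Rightarrow> real" where
  "wave_vector L \<kappa> l = 2 * pi * real_of_int (\<kappa> l) / L l"

definition aliasing_representatives :: "nat \<Rightarrow> (nat \<Rightarrow> nat) \<Rightarrow> (nat \<Rightarrow> int) set \<Rightarrow> bool" where
  "aliasing_representatives d N F \<longleftrightarrow>
     F \<subseteq> PiE {..<d} (\<lambda>l. {\<kappa>. real_of_int \<bar>\<kappa>\<bar> \<le> real (N l) / 2}) \<and>
     card F = grid_size d N \<and>
     (\<forall>\<kappa>\<in>F. \<forall>\<kappa>'\<in>F. (\<forall>l<d. \<kappa> l mod int (N l) = \<kappa>' l mod int (N l)) \<longrightarrow> \<kappa> = \<kappa>')"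

definition phase :: "nat \<Rightarrow> (nat \<Rightarrow> real) \<Rightarrow> (nat \<Rightarrow> nat) \<Rightarrow> (nat \<Rightarrow> nat \<Rightarrow> nat) \<Rightarrow> (nat \<Rightarrow> int) \<Rightarrow> nat \<Rightarrow> real"
  where "phase d L N \<nu> \<kappa> p = (\<Sum>l<d. wave_vector L \<kappa> l * node L N \<nu> p l)"

definition fourier_coeff ::
    "nat \<Rightarrow> (nat \<Rightarrow> real) \<Rightarrow> (nat \<Rightarrow> nat) \<Rightarrow> (nat \<Rightarrow> nat \<Rightarrow> nat) \<Rightarrow> (nat \<Rightarrow> complex) \<Rightarrow> (nat \<Rightarrow> int) \<Rightarrow> complex"
  where "fourier_coeff d L N \<nu> u \<kappa> =
    (\<Sum>p<grid_size d N. u p * cis (- phase d L N \<nu> \<kappa> p)) / of_nat (grid_size d N)"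

definition neg_laplacian ::
    "nat \<Rightarrow> (nat \<Rightarrow> real) \<Rightarrow> (nat \<Rightarrow> nat) \<Rightarrow> (nat \<Rightarrow> nat \<Rightarrow> nat) \<Rightarrow> (nat \<Rightarrow> int) set \<Rightarrow> (nat \<Rightarrow> complex) \<Rightarrow> nat \<Rightarrow> complex"
  where "neg_laplacian d L N \<nu> F u p =
    (\<Sum>\<kappa>\<in>F. of_real (\<Sum>l<d. (wave_vector L \<kappa> l)\<^sup>2) * fourier_coeff d L N \<nu> u \<kappa> * cis (phase d L N \<nu> \<kappa> p))"

lemma cis_alias:
  assumes L: "\<And>l. l < d \<Longrightarrow> L l \<noteq> 0" and N: "\<And>l. l < d \<Longrightarrow> N l > 0"
    and al: "\<And>l. l < d \<Longrightarrow> \<kappa> l mod int (N l) = \<kappa>' l mod int (N l)"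
  shows "cis (phase d L N \<nu> \<kappa> p) = cis (phase d L N \<nu> \<kappa>' p)"
proof -
  have "\<exists>z. \<kappa> l = \<kappa>' l + int (N l) * z" if "l < d" for l
    using al[OF that] by (metis mod_eqE)
  then obtain z where z: "\<And>l. l < d \<Longrightarrow> \<kappa> l = \<kappa>' l + int (N l) * z l" by metis
  define s where "s = (\<Sum>l<d. z l * int (\<nu> p l))"
  have "phase d L N \<nu> \<kappa> p = (\<Sum>l<d. wave_vector L \<kappa>' l * node L N \<nu> p l + 2 * pi * real_of_int (z l * int (\<nu> p l)))"
    unfolding phase_def
  proof (rule sum.cong[OF refl])
    fix l assume "l \<in> {..<d}"
    then have l: "l < d" by simp
    show "wave_vector L \<kappa> l * node L N \<nu> p l
        = wave_vector L \<kappa>' l * node L N \<nu> p l + 2 * pi * real_of_int (z l * int (\<nu> p l))"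
      using L[OF l] N[OF l] by (simp add: wave_vector_def node_def z[OF l] field_simps)
  qed
  also have "\<dots> = phase d L N \<nu> \<kappa>' p + 2 * pi * real_of_int s"
    by (simp add: phase_def sum.distrib s_def sum_distrib_left)
  finally show ?thesis
    by (simp add: cis_mult[symmetric] cis_multiple_2pi)
qed

text \<open>A real grid function has a real image because \<open>F\<close> is invariant under negation up to aliasing,
  and aliases in the admissible range have wave vectors of the same length.\<close>

lemma neg_laplacian_real:
  assumes L: "\<And>l. l < d \<Longrightarrow> L l > 0" and N: "\<And>l. l < d \<Longrightarrow> N l > 0"
    and F: "aliasing_representatives d N F"
  shows "neg_laplacian d L N \<nu> F (\<lambda>q. of_real (u q)) p \<in> \<real>"
proof -
  let ?R = "PiE {..<d} (\<lambda>l. {0..<int (N l)})"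
  define red where "red \<kappa> = restrict (\<lambda>l. \<kappa> l mod int (N l)) {..<d}" for \<kappa> :: "nat \<Rightarrow> int"
  have FP: "F \<subseteq> PiE {..<d} (\<lambda>l. {\<kappa>. real_of_int \<bar>\<kappa>\<bar> \<le> real (N l) / 2})"
    and card: "card F = grid_size d N"
    and inj: "\<And>\<kappa> \<kappa>'. \<kappa> \<in> F \<Longrightarrow> \<kappa>' \<in> F \<Longrightarrow> (\<forall>l<d. \<kappa> l mod int (N l) = \<kappa>' l mod int (N l)) \<Longrightarrow> \<kappa> = \<kappa>'"
    using F unfolding aliasing_representatives_def by blast+
  have gpos: "grid_size d N > 0" using N by (auto simp: grid_size_def intro!: prod_pos)
  then have finF: "finite F" using card card.infinite by fastforce
  have injred: "inj_on red F"
  proof (rule inj_onI)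
    fix \<kappa> \<kappa>' assume k: "\<kappa> \<in> F" "\<kappa>' \<in> F" and eq: "red \<kappa> = red \<kappa>'"
    have "\<kappa> l mod int (N l) = \<kappa>' l mod int (N l)" if "l < d" for l
      using fun_cong[OF eq, of l] that by (simp add: red_def)
    then show "\<kappa> = \<kappa>'" using inj[OF k] by blast
  qed
  have redR: "red \<kappa> \<in> ?R" for \<kappa>
    using N by (auto simp: red_def)
  have cardR: "card ?R = grid_size d N"
    by (simp add: card_PiE grid_size_def)
  have finR: "finite ?R" by (simp add: finite_PiE)
  have imR: "red ` F = ?R"
    by (rule card_subset_eq[OF finR]) (use redR in blast, simp add: card_image[OF injred] card cardR)
  define r where "r \<kappa> = inv_into F red (red (\<lambda>l. - \<kappa> l))" for \<kappa>
  have rF: "r \<kappa> \<in> F" and rred: "red (r \<kappa>) = red (\<lambda>l. - \<kappa> l)" for \<kappa>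
    using redR[of "\<lambda>l. - \<kappa> l"] imR by (auto simp: r_def inv_into_into f_inv_into_f)
  have rmod: "r \<kappa> l mod int (N l) = (- \<kappa> l) mod int (N l)" if "l < d" for \<kappa> l
    using fun_cong[OF rred, of \<kappa> l] that by (simp add: red_def)
  have rinj: "inj_on r F"
  proof (rule inj_onI)
    fix \<kappa> \<kappa>' assume k: "\<kappa> \<in> F" "\<kappa>' \<in> F" and eq: "r \<kappa> = r \<kappa>'"
    have "\<kappa> l mod int (N l) = \<kappa>' l mod int (N l)" if "l < d" for l
      using rmod[OF that, of \<kappa>] rmod[OF that, of \<kappa>'] eq
      by (metis minus_minus mod_minus_cong)
    then show "\<kappa> = \<kappa>'" using inj[OF k] by blast
  qed
  have rim: "r ` F = F"
    using rF rinj finF by (intro endo_inj_surj) auto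
  have rsq: "(wave_vector L (r \<kappa>) l)\<^sup>2 = (wave_vector L \<kappa> l)\<^sup>2" if k: "\<kappa> \<in> F" and l: "l < d" for \<kappa> l
  proof -
    have "real_of_int \<bar>\<kappa> l\<bar> \<le> real (N l) / 2" "real_of_int \<bar>r \<kappa> l\<bar> \<le> real (N l) / 2"
      using FP k rF[of \<kappa>] l by (force simp: PiE_def Pi_def)+
    then have b: "2 * \<bar>\<kappa> l\<bar> \<le> int (N l)" "2 * \<bar>r \<kappa> l\<bar> \<le> int (N l)" by linarith+
    obtain z where z: "r \<kappa> l = - \<kappa> l + int (N l) * z"
      using rmod[OF l, of \<kappa>] by (metis mod_eqE)
    have n: "int (N l) > 0" using N[OF l] by simp
    have zb: "\<bar>int (N l) * z\<bar> \<le> int (N l)" using b z by linarith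
    then have "\<bar>z\<bar> \<le> 1" using n by (simp add: abs_mult)
    then consider "z = 0" | "z = 1" | "z = -1" by linarith
    then have "\<bar>r \<kappa> l\<bar> = \<bar>\<kappa> l\<bar>" using b z by cases auto
    then have "(r \<kappa> l)\<^sup>2 = (\<kappa> l)\<^sup>2" by (simp add: power2_eq_iff abs_eq_iff)
    then have "(real_of_int (r \<kappa> l))\<^sup>2 = (real_of_int (\<kappa> l))\<^sup>2" by (metis of_int_power)
    then show ?thesis by (simp add: wave_vector_def power_mult_distrib power_divide)
  qed
  have cisneg: "cis (phase d L N \<nu> (r \<kappa>) q) = cis (- phase d L N \<nu> \<kappa> q)" for \<kappa> q
  proof -
    have "cis (phase d L N \<nu> (r \<kappa>) q) = cis (phase d L N \<nu> (\<lambda>l. - \<kappa> l) q)"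
      by (rule cis_alias) (use L N rmod in force)+
    also have "phase d L N \<nu> (\<lambda>l. - \<kappa> l) q = - phase d L N \<nu> \<kappa> q"
      by (simp add: phase_def wave_vector_def sum_negf)
    finally show ?thesis .
  qed
  have cisneg': "cis (- phase d L N \<nu> (r \<kappa>) q) = cis (phase d L N \<nu> \<kappa> q)" for \<kappa> q
    using cisneg[of \<kappa> q] by (metis cis_cnj complex_cnj_cnj)
  have coef: "fourier_coeff d L N \<nu> (\<lambda>q. of_real (u q)) (r \<kappa>)
      = cnj (fourier_coeff d L N \<nu> (\<lambda>q. of_real (u q)) \<kappa>)" for \<kappa>
    by (simp add: fourier_coeff_def cisneg' cis_cnj)
  have "cnj (neg_laplacian d L N \<nu> F (\<lambda>q. of_real (u q)) p)
      = (\<Sum>\<kappa>\<in>F. of_real (\<Sum>l<d. (wave_vector L (r \<kappa>) l)\<^sup>2)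
          * fourier_coeff d L N \<nu> (\<lambda>q. of_real (u q)) (r \<kappa>) * cis (phase d L N \<nu> (r \<kappa>) p))"
    unfolding neg_laplacian_def
    by (simp add: coef cisneg cis_cnj rsq flip: of_real_power)
  also have "\<dots> = neg_laplacian d L N \<nu> F (\<lambda>q. of_real (u q)) p"
    unfolding neg_laplacian_def by (rule sum.reindex_bij_betw) (simp add: bij_betw_def rinj rim)
  finally show ?thesis by (simp add: Reals_cnj_iff)
qed

section \<open>The saddle-point matrices\<close>

text \<open>Unknowns are ordered node by node: component \<open>c \<in> {0, 1, 2}\<close> at node \<open>p\<close> has index \<open>3 * p + c\<close>.
  The type \<^typ>\<open>3\<close> has the elements 1, 2 and 3 = 0, so component 0 is sent to 1.\<close>

definition component :: "nat \<Rightarrow> 3" where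
  "component s = of_nat (Suc (s mod 3))"

text \<open>By \<open>neg_laplacian_real\<close>, taking real parts in the following definition loses nothing.\<close>

definition neg_laplacian_mat ::
    "nat \<Rightarrow> (nat \<Rightarrow> real) \<Rightarrow> (nat \<Rightarrow> nat) \<Rightarrow> (nat \<Rightarrow> nat \<Rightarrow> nat) \<Rightarrow> (nat \<Rightarrow> int) set \<Rightarrow> real mat"
  where "neg_laplacian_mat d L N \<nu> F =
    Matrix.mat (3 * grid_size d N) (3 * grid_size d N) (\<lambda>(r, s).
      if component r = component s
      then Re (neg_laplacian d L N \<nu> F (\<lambda>q. if q = s div 3 then 1 else 0) (r div 3)) else 0)"

definition H_mat ::
    "nat \<Rightarrow> (nat \<Rightarrow> real) \<Rightarrow> (nat \<Rightarrow> nat) \<Rightarrow> (nat \<Rightarrow> nat \<Rightarrow> nat) \<Rightarrow> (nat \<Rightarrow> int) set \<Rightarrow>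
      real \<Rightarrow> real \<Rightarrow> real \<Rightarrow> real \<Rightarrow> real mat"
  where "H_mat d L N \<nu> F \<alpha> \<theta> k C =
    \<alpha> \<cdot>\<^sub>m 1\<^sub>m (3 * grid_size d N) + (\<theta> * k * C) \<cdot>\<^sub>m neg_laplacian_mat d L N \<nu> F"

definition S_mat :: "nat \<Rightarrow> (nat \<Rightarrow> real^3) \<Rightarrow> real mat" where
  "S_mat Ng m = Matrix.mat (3 * Ng) (3 * Ng) (\<lambda>(r, s).
     if r div 3 = s div 3
     then vec_nth (cross3 (m (r div 3)) (axis (component s) 1)) (component r) else 0)"

definition B_mat :: "nat \<Rightarrow> (nat \<Rightarrow> real^3) \<Rightarrow> real mat" where
  "B_mat Ng m = Matrix.mat Ng (3 * Ng) (\<lambda>(p, s).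
     if s div 3 = p then vec_nth (m p) (component s) else 0)"

definition saddle_mat :: "nat \<Rightarrow> real mat \<Rightarrow> (nat \<Rightarrow> real^3) \<Rightarrow> real mat" where
  "saddle_mat Ng H m =
     four_block_mat (H + S_mat Ng m) (transpose_mat (B_mat Ng m)) (- B_mat Ng m) (0\<^sub>m Ng Ng)"

definition precond_mat :: "nat \<Rightarrow> real mat \<Rightarrow> (nat \<Rightarrow> real^3) \<Rightarrow> real \<Rightarrow> real mat" where
  "precond_mat Ng H m lam =
     (lam \<cdot>\<^sub>m 1\<^sub>m (4 * Ng)
        + four_block_mat H (0\<^sub>m (3 * Ng) Ng) (0\<^sub>m Ng (3 * Ng)) (0\<^sub>m Ng Ng))
   * (lam \<cdot>\<^sub>m 1\<^sub>m (4 * Ng)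
        + four_block_mat (S_mat Ng m) (transpose_mat (B_mat Ng m)) (- B_mat Ng m) (0\<^sub>m Ng Ng))"

definition orthonormal_kernel_basis :: "nat \<Rightarrow> real mat \<Rightarrow> real mat \<Rightarrow> bool" where
  "orthonormal_kernel_basis Ng B Z \<longleftrightarrow>
     Z \<in> carrier_mat (3 * Ng) (2 * Ng) \<and>
     transpose_mat Z * Z = 1\<^sub>m (2 * Ng) \<and>
     vec_space.col_space (3 * Ng) Z = mat_kernel B"

text \<open>The spectrum of the real matrix \<open>H\<^sub>T = Z\<^sup>T H Z\<close> is its set of complex eigenvalues.\<close>

definition q_T :: "real mat \<Rightarrow> real mat \<Rightarrow> real \<Rightarrow> real" where
  "q_T H Z lam = Max ((\<lambda>\<mu>. cmod ((of_real lam - \<mu>) / (of_real lam + \<mu>))) `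
     spectrum (map_mat complex_of_real (transpose_mat Z * H * Z)))"

section \<open>Left-preconditioned GMRES\<close>

definition vec_norm :: "real Matrix.vec \<Rightarrow> real" where
  "vec_norm v = L2_set (vec_index v) {..<dim_vec v}"

text \<open>Unspecified for singular \<open>M\<close>.\<close>

definition mat_inv :: "real mat \<Rightarrow> real mat" where
  "mat_inv M = the (mat_inverse M)"

definition precond_residual ::
    "real mat \<Rightarrow> real mat \<Rightarrow> real Matrix.vec \<Rightarrow> real Matrix.vec \<Rightarrow> real Matrix.vec" where
  "precond_residual M A b x = mat_inv M *\<^sub>v (b - A *\<^sub>v x)"

definition krylov :: "real mat \<Rightarrow> real Matrix.vec \<Rightarrow> nat \<Rightarrow> real Matrix.vec set" where
  "krylov P r j = LinearCombinations.module.span class_ring (module_vec TYPE(real) (dim_row P))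
     ((\<lambda>i. (P ^\<^sub>m i) *\<^sub>v r) ` {..<j})"

definition gmres_iterate ::
    "real mat \<Rightarrow> real mat \<Rightarrow> real Matrix.vec \<Rightarrow> real Matrix.vec \<Rightarrow> nat \<Rightarrow> real Matrix.vec \<Rightarrow> bool" where
  "gmres_iterate M A b x0 j x \<longleftrightarrow>
     (let K = (\<lambda>v. x0 + v) ` krylov (mat_inv M * A) (precond_residual M A b x0) j
      in x \<in> K \<and> (\<forall>y\<in>K. vec_norm (precond_residual M A b x) \<le> vec_norm (precond_residual M A b y)))"

end

theory Submission
  imports Defs
begin

text \<open>Write \<open>K\<close> and \<open>S\<close> for the symmetric and the skew part of the saddle-point matrix.  Then
  \<open>1 - 2\<lambda>P\<^sub>\<lambda> = M\<^sub>\<lambda>\<^sup>-\<^sup>1(\<lambda> - K)(\<lambda> - S)\<close>, which \<open>\<lambda> + S\<close> conjugates to \<open>QV\<close>, where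
  \<open>Q = (\<lambda> + K)\<^sup>-\<^sup>1(\<lambda> - K)\<close> and the Cayley transform \<open>V = (\<lambda> - S)(\<lambda> + S)\<^sup>-\<^sup>1\<close> is an isometry.
  \<open>Q\<close> is diagonal in Fourier space: it contracts the vector components by \<open>q\<^sub>0\<close> and fixes the scalar
  components.  At each node \<open>V\<close> couples the scalar to the vector component with strength
  \<open>2\<lambda>|m|/(\<lambda>\<^sup>2 + |m|\<^sup>2) \<ge> \<gamma>\<^sub>0\<close>, so a vector that escapes damping in one step is damped in the next,
  and \<open>(QV)\<^sup>2\<close> contracts by \<open>\<vartheta>\<^sub>0\<close>.  Since \<open>(\<lambda> + S)\<^sup>T(\<lambda> + S)\<close> acts at each node as the scalar
  \<open>\<lambda>\<^sup>2 + |m|\<^sup>2\<close>, undoing the conjugation costs the factor \<open>\<kappa>\<^sub>0\<close>.  The residual polynomial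
  \<open>(1 - 2\<lambda>z)\<^sup>2\<^sup>j\<close> is a competitor in the minimization that defines GMRES.\<close>

section \<open>Fourier modes on a periodic grid\<close>

text \<open>The summands are the powers of the \<open>n\<close>-th root of unity \<open>z\<close>,
  and their geometric sum vanishes unless \<open>z = 1\<close>.\<close>

lemma sum_cis_roots_of_unity:
  assumes "n > 0"
  shows "(\<Sum>j<n. cis (2 * pi * real_of_int a * real j / real n))
    = (if int n dvd a then of_nat n else 0)"
proof -
  define z where "z = cis (2 * pi * real_of_int a / real n)"
  have pow: "cis (2 * pi * real_of_int a * real j / real n) = z ^ j" for j
    by (simp add: z_def DeMoivre field_simps)
  have "z ^ n = cis (2 * pi * real_of_int a)"
    using assms by (simp add: z_def DeMoivre field_simps)
  then have zn: "z ^ n = 1"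
    by (simp add: cis_multiple_2pi)
  have z1: "z = 1 \<longleftrightarrow> int n dvd a"
  proof
    assume "z = 1"
    then obtain b :: int where "2 * pi * real_of_int a / real n = b * (2 * pi)"
      by (metis z_def cis.sel(1) one_complex.sel(1) cos_one_2pi_int mult.assoc)
    then have "real_of_int a = real_of_int (int n * b)"
      using assms by (simp add: field_simps)
    then show "int n dvd a"
      by (metis dvd_triv_left of_int_eq_iff)
  next
    assume "int n dvd a"
    then obtain b where "a = int n * b" by blast
    then show "z = 1" 
      using assms cis_multiple_2pi[of "real_of_int b"] by (simp add: z_def mult.assoc)
  qed
  show ?thesis
  proof (cases "z = 1")
    case False
    then show ?thesis using z1 zn by (simp add: pow sum_gp_strict)
  qed (use z1 in \<open>simp add: pow\<close>)
qed

lemma cis_sum: "finite A \<Longrightarrow> cis (\<Sum>x\<in>A. f x) = (\<Prod>x\<in>A. cis (f x))"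
  by (induction A rule: finite_induct) (simp_all flip: cis_mult)

text \<open>The exponential of a sum factors, so the grid sum is a product of one-dimensional sums
  over roots of unity.\<close>

lemma sum_cis_grid:
  assumes "\<And>l. l < d \<Longrightarrow> N l > 0"
  shows "(\<Sum>g\<in>PiE {..<d} (\<lambda>l. {..<N l}). cis (\<Sum>l<d. 2 * pi * real_of_int (a l) * real (g l) / real (N l)))
    = (if \<forall>l<d. int (N l) dvd a l then of_nat (grid_size d N) else 0)"
proof -
  have "(\<Sum>g\<in>PiE {..<d} (\<lambda>l. {..<N l}). cis (\<Sum>l<d. 2 * pi * real_of_int (a l) * real (g l) / real (N l)))
    = (\<Sum>g\<in>PiE {..<d} (\<lambda>l. {..<N l}). \<Prod>l<d. cis (2 * pi * real_of_int (a l) * real (g l) / real (N l)))"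
    by (simp add: cis_sum)
  also have "\<dots> = (\<Prod>l<d. \<Sum>j<N l. cis (2 * pi * real_of_int (a l) * real j / real (N l)))"
    by (simp add: prod_sum_PiE)
  also have "\<dots> = (\<Prod>l<d. if int (N l) dvd a l then of_nat (N l) else 0)"
    using assms by (intro prod.cong) (auto simp: sum_cis_roots_of_unity)
  also have "\<dots> = (if \<forall>l<d. int (N l) dvd a l then of_nat (grid_size d N) else 0)"
    by (auto simp: grid_size_def intro!: prod.cong)
  finally show ?thesis .
qed

section \<open>Discrete Fourier analysis on one member of the family\<close>

locale periodic_grid =
  fixes d :: nat and L :: "nat \<Rightarrow> real" and N :: "nat \<Rightarrow> nat"
    and \<nu> :: "nat \<Rightarrow> nat \<Rightarrow> nat" and F :: "(nat \<Rightarrow> int) set"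
  assumes L: "l < d \<Longrightarrow> L l > 0"
    and N: "l < d \<Longrightarrow> N l > 0"
    and numbering: "node_numbering d N \<nu>"
    and F: "aliasing_representatives d N F"
begin

abbreviation "n \<equiv> grid_size d N"
abbreviation "mode \<kappa> p \<equiv> cis (phase d L N \<nu> \<kappa> p)"
abbreviation "mode' \<kappa> p \<equiv> cis (- phase d L N \<nu> \<kappa> p)"
abbreviation "hat \<equiv> fourier_coeff d L N \<nu>"
abbreviation "lap \<equiv> neg_laplacian d L N \<nu> F"

definition "symb \<kappa> = (\<Sum>l<d. (wave_vector L \<kappa> l)\<^sup>2)"

lemma n_pos: "n > 0"
  using N by (auto simp: grid_size_def intro!: prod_pos)

text \<open>A set of positive cardinality is finite, because \<open>card\<close> sends infinite sets
  to 0.\<close>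

lemma finite_F: "finite F"
  using F n_pos card.infinite unfolding aliasing_representatives_def by fastforce

lemma phase_eq: "phase d L N \<nu> \<kappa> p = (\<Sum>l<d. 2 * pi * real_of_int (\<kappa> l) * real (\<nu> p l) / real (N l))"
  unfolding phase_def
  by (rule sum.cong) (use L in \<open>auto simp: wave_vector_def node_def less_imp_neq[symmetric]\<close>)

lemma mode_mult: "mode \<kappa> p * mode' \<kappa>' p
    = cis (\<Sum>l<d. 2 * pi * real_of_int (\<kappa> l - \<kappa>' l) * real (\<nu> p l) / real (N l))"
  unfolding cis_mult phase_eq
  by (simp add: sum_subtractf[symmetric] algebra_simps diff_divide_distrib)

text \<open>Renumbering the nodes by multi-indices turns this into \<open>sum_cis_grid\<close> with
  frequency \<kappa> - \<kappa>'. That difference is divisible in every direction only for equal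
  indices, since \<open>F\<close> contains no two distinct aliases.\<close>

lemma modes_orthogonal:
  assumes "\<kappa> \<in> F" "\<kappa>' \<in> F"
  shows "(\<Sum>p<n. mode \<kappa> p * mode' \<kappa>' p) = (if \<kappa> = \<kappa>' then of_nat n else 0)"
proof -
  have "(\<Sum>p<n. mode \<kappa> p * mode' \<kappa>' p)
      = (\<Sum>g\<in>PiE {..<d} (\<lambda>l. {..<N l}). cis (\<Sum>l<d. 2 * pi * real_of_int (\<kappa> l - \<kappa>' l) * real (g l) / real (N l)))"
    unfolding mode_mult
    using numbering unfolding node_numbering_def by (rule sum.reindex_bij_betw)
  also have "\<dots> = (if \<forall>l<d. int (N l) dvd \<kappa> l - \<kappa>' l then of_nat n else 0)"
    using N by (intro sum_cis_grid)
  also have "(\<forall>l<d. int (N l) dvd \<kappa> l - \<kappa>' l) \<longleftrightarrow> \<kappa> = \<kappa>'"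
    using F assms by (auto simp: aliasing_representatives_def mod_eq_dvd_iff)
  finally show ?thesis .
qed

text \<open>The dual relation, summing over wave indices instead of nodes. Reduction modulo
  \<open>N l\<close> maps \<open>F\<close> bijectively onto the box of nodal multi-indices and
  preserves the values of the modes at the nodes. The sum is therefore again a grid sum, with the
  difference of the two multi-indices as frequency.\<close>

lemma modes_complete:
  assumes "p < n" "q < n"
  shows "(\<Sum>\<kappa>\<in>F. mode \<kappa> p * mode' \<kappa> q) = (if p = q then of_nat n else 0)"
proof -
  let ?R = "PiE {..<d} (\<lambda>l. {..<N l})"
  define red where "red \<kappa> = restrict (\<lambda>l. nat (\<kappa> l mod int (N l))) {..<d}" for \<kappa> :: "nat \<Rightarrow> int"
  have red: "int (red \<kappa> l) = \<kappa> l mod int (N l)" if "l < d" for \<kappa> l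
    using N[OF that] that by (simp add: red_def)
  have inj: "inj_on red F"
  proof (rule inj_onI)
    fix \<kappa> \<kappa>' assume "\<kappa> \<in> F" "\<kappa>' \<in> F" and eq: "red \<kappa> = red \<kappa>'"
    moreover have "\<forall>l<d. \<kappa> l mod int (N l) = \<kappa>' l mod int (N l)"
      using red eq by metis
    ultimately show "\<kappa> = \<kappa>'"
      using F unfolding aliasing_representatives_def by blast
  qed
  have "red ` F = ?R"
  proof (rule card_subset_eq)
    show "red ` F \<subseteq> ?R"
      using N by (auto simp: red_def nat_less_iff split: if_splits)
    show "card (red ` F) = card ?R"
      using F by (simp add: card_image[OF inj] card_PiE grid_size_def aliasing_representatives_def)
  qed (simp add: finite_PiE)
  with inj have bij: "bij_betw red F ?R"
    by (simp add: bij_betw_def)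
  have "(\<Sum>\<kappa>\<in>F. mode \<kappa> p * mode' \<kappa> q)
      = (\<Sum>\<kappa>\<in>F. cis (\<Sum>l<d. 2 * pi * real_of_int (int (\<nu> p l) - int (\<nu> q l)) * real (red \<kappa> l) / real (N l)))"
  proof (rule sum.cong[OF refl])
    fix \<kappa>
    have eq: "mode \<kappa> p = mode (\<lambda>l. int (red \<kappa> l)) p" for p
      by (rule cis_alias) (use L N red in \<open>force+\<close>)
    have "mode' \<kappa> q = mode' (\<lambda>l. int (red \<kappa> l)) q"
      using eq[of q] by (metis cis_cnj)
    then have "mode \<kappa> p * mode' \<kappa> q = mode (\<lambda>l. int (red \<kappa> l)) p * mode' (\<lambda>l. int (red \<kappa> l)) q"
      by (simp only: eq[of p])
    then show "mode \<kappa> p * mode' \<kappa> q = cis (\<Sum>l<d. 2 * pi * real_of_int (int (\<nu> p l) - int (\<nu> q l)) * real (red \<kappa> l) / real (N l))"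
      unfolding cis_mult phase_eq
      by (simp add: sum_subtractf[symmetric] algebra_simps diff_divide_distrib)
  qed
  also have "\<dots> = (\<Sum>g\<in>?R. cis (\<Sum>l<d. 2 * pi * real_of_int (int (\<nu> p l) - int (\<nu> q l)) * real (g l) / real (N l)))"
    using bij by (rule sum.reindex_bij_betw)
  also have "\<dots> = (if \<forall>l<d. int (N l) dvd int (\<nu> p l) - int (\<nu> q l) then of_nat n else 0)"
    using N by (intro sum_cis_grid)
  also have "(\<forall>l<d. int (N l) dvd int (\<nu> p l) - int (\<nu> q l)) \<longleftrightarrow> p = q"
  proof
    assume *: "\<forall>l<d. int (N l) dvd int (\<nu> p l) - int (\<nu> q l)"
    have \<nu>: "\<nu> p \<in> ?R" "\<nu> q \<in> ?R"
      using numbering assms unfolding node_numbering_def by (auto dest: bij_betwE)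
    have "\<nu> p = \<nu> q"
    proof (rule PiE_ext[OF \<nu>])
      fix l assume l: "l \<in> {..<d}"
      then have "\<nu> p l < N l" "\<nu> q l < N l" using \<nu> by auto
      moreover have "int (\<nu> p l) mod int (N l) = int (\<nu> q l) mod int (N l)"
        using * l by (simp add: mod_eq_dvd_iff)
      ultimately show "\<nu> p l = \<nu> q l" by simp
    qed
    then show "p = q"
      using numbering assms unfolding node_numbering_def bij_betw_def inj_on_def by blast
  qed simp
  finally show ?thesis .
qed

lemma fourier_inversion:
  assumes "p < n"
  shows "u p = (\<Sum>\<kappa>\<in>F. hat u \<kappa> * mode \<kappa> p)"
proof -
  have "(\<Sum>\<kappa>\<in>F. hat u \<kappa> * mode \<kappa> p) = (\<Sum>\<kappa>\<in>F. \<Sum>q<n. u q * (mode \<kappa> p * mode' \<kappa> q) / of_nat n)"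
    unfolding fourier_coeff_def
    by (simp add: sum_distrib_right sum_distrib_left sum_divide_distrib mult_ac)
  also have "\<dots> = (\<Sum>q<n. u q * (\<Sum>\<kappa>\<in>F. mode \<kappa> p * mode' \<kappa> q) / of_nat n)"
    by (subst sum.swap) (simp add: sum_distrib_left sum_divide_distrib)
  also have "\<dots> = (\<Sum>q<n. if q = p then u q else 0)"
    using assms n_pos by (intro sum.cong) (auto simp: modes_complete)
  finally show ?thesis using assms by simp
qed

text \<open>Polarized form: \<open>u\<close> is expanded by Fourier inversion, and the remaining
  sums against \<open>v\<close> are conjugates of its coefficients by definition.\<close>

lemma parseval:
  "(\<Sum>p<n. cnj (v p) * u p) = of_nat n * (\<Sum>\<kappa>\<in>F. cnj (hat v \<kappa>) * hat u \<kappa>)"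
proof -
  have hat: "of_nat n * cnj (hat v \<kappa>) = (\<Sum>p<n. cnj (v p) * mode \<kappa> p)" for \<kappa>
    using n_pos by (simp add: fourier_coeff_def cis_cnj)
  have "(\<Sum>p<n. cnj (v p) * u p) = (\<Sum>p<n. \<Sum>\<kappa>\<in>F. hat u \<kappa> * (cnj (v p) * mode \<kappa> p))"
    by (intro sum.cong) (auto simp: fourier_inversion[of _ u] sum_distrib_left mult_ac)
  also have "\<dots> = (\<Sum>\<kappa>\<in>F. hat u \<kappa> * (of_nat n * cnj (hat v \<kappa>)))"
    by (subst sum.swap) (simp add: hat sum_distrib_left)
  finally show ?thesis by (simp add: sum_distrib_left mult_ac)
qed

lemma parseval_norm:
  "(\<Sum>p<n. (cmod (u p))\<^sup>2) = of_nat n * (\<Sum>\<kappa>\<in>F. (cmod (hat u \<kappa>))\<^sup>2)"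
proof -
  have "complex_of_real (\<Sum>p<n. (cmod (u p))\<^sup>2) = of_real (of_nat n * (\<Sum>\<kappa>\<in>F. (cmod (hat u \<kappa>))\<^sup>2))"
    using parseval[of u u] by (simp only: mult.commute[of "cnj _"] complex_norm_square[symmetric]) simp
  then show ?thesis by (simp only: of_real_eq_iff)
qed

text \<open>By orthogonality only the mode \<kappa> survives in its own coefficient, so
  \<open>symb \<kappa>\<close> is the eigenvalue of \<open>lap\<close> on that mode.\<close>

lemma hat_lap:
  assumes "\<kappa> \<in> F"
  shows "hat (lap u) \<kappa> = of_real (symb \<kappa>) * hat u \<kappa>"
proof -
  have "hat (lap u) \<kappa> = (\<Sum>p<n. \<Sum>\<kappa>'\<in>F. of_real (symb \<kappa>') * hat u \<kappa>' * (mode \<kappa>' p * mode' \<kappa> p)) / of_nat n"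
    unfolding fourier_coeff_def[of _ _ _ _ "lap u"] neg_laplacian_def symb_def[symmetric]
    by (simp add: sum_distrib_left sum_distrib_right mult_ac)
  also have "\<dots> = (\<Sum>\<kappa>'\<in>F. of_real (symb \<kappa>') * hat u \<kappa>' * (\<Sum>p<n. mode \<kappa>' p * mode' \<kappa> p)) / of_nat n"
    by (subst sum.swap) (simp add: sum_distrib_left)
  also have "\<dots> = (\<Sum>\<kappa>'\<in>F. if \<kappa>' = \<kappa> then of_real (symb \<kappa>) * hat u \<kappa> * of_nat n else 0) / of_nat n"
    using assms by (intro arg_cong2[where f="(/)"] sum.cong) (auto simp: modes_orthogonal)
  finally show ?thesis using assms finite_F n_pos by simp
qed

lemma hat_linear: "hat (\<lambda>p. a * u p + b * v p) \<kappa> = a * hat u \<kappa> + b * hat v \<kappa>"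
  unfolding fourier_coeff_def
  by (simp add: sum.distrib sum_distrib_left algebra_simps add_divide_distrib)

text \<open>Equations between grid functions that come from vectors hold at the \<open>n\<close>
  nodes only; \<open>hat\<close> does not see the values elsewhere.\<close>

lemma hat_cong: "(\<And>p. p < n \<Longrightarrow> u p = v p) \<Longrightarrow> hat u = hat v"
  unfolding fourier_coeff_def by (intro ext) simp

lemma symb_nonneg: "symb \<kappa> \<ge> 0"
  unfolding symb_def by (simp add: sum_nonneg)

text \<open>A representative has \<open>|\<kappa> l| <= N l / 2\<close>, so each component of its
  wave vector is at most \<open>pi * N l / L l <= pi / h\<close>, and the squares of
  \<open>d\<close> components add up. The factor \<open>d * pi^2\<close> in \<open>\<beta>0\<close>
  comes from here.\<close>

lemma symb_le:
  assumes "\<kappa> \<in> F" "d > 0"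
  shows "symb \<kappa> \<le> real d * pi\<^sup>2 / (mesh_width d L N)\<^sup>2"
proof -
  let ?h = "mesh_width d L N"
  have h: "0 < ?h" unfolding mesh_width_def
    using L N \<open>d > 0\<close> by (subst Min_gr_iff) auto
  have "(wave_vector L \<kappa> l)\<^sup>2 \<le> pi\<^sup>2 / ?h\<^sup>2" if l: "l < d" for l
  proof -
    have hl: "?h \<le> L l / real (N l)" unfolding mesh_width_def using l by (intro Min_le) auto
    have "real_of_int \<bar>\<kappa> l\<bar> \<le> real (N l) / 2"
      using F assms l unfolding aliasing_representatives_def by (force simp: PiE_def Pi_def)
    then have "\<bar>wave_vector L \<kappa> l\<bar> \<le> pi * real (N l) / L l"
      using L[OF l] by (simp add: wave_vector_def abs_mult divide_simps)
    also have "\<dots> \<le> pi / ?h"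
      using hl h L[OF l] N[OF l] by (simp add: field_simps)
    finally have "\<bar>wave_vector L \<kappa> l\<bar>\<^sup>2 \<le> (pi / ?h)\<^sup>2"
      by (rule power_mono) simp
    then show ?thesis by (simp add: power_divide)
  qed
  then have "symb \<kappa> \<le> (\<Sum>l<d. pi\<^sup>2 / ?h\<^sup>2)"
    unfolding symb_def by (intro sum_mono) auto
  then show ?thesis by simp
qed

end

section \<open>Nodal components\<close>

lemma component_simps [simp]:
  "component (3 * p) = 1" "component (Suc (3 * p)) = 2" "component (Suc (Suc (3 * p))) = 3"
proof -
  have "Suc (3 * p) mod 3 = 1" "Suc (Suc (3 * p)) mod 3 = 2" by presburger+
  then show "component (3 * p) = 1" "component (Suc (3 * p)) = 2" "component (Suc (Suc (3 * p))) = 3"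
    by (simp_all add: component_def)
qed

lemma component_eq_iff: "component r = component s \<longleftrightarrow> r mod 3 = s mod 3"
proof -
  have "r mod 3 \<in> {0, 1, 2}" "s mod 3 \<in> {0, 1, 2}" by auto
  then show ?thesis by (auto simp: component_def)
qed

lemma sum_lessThan_3_mult:
  fixes f :: "nat \<Rightarrow> 'a::comm_monoid_add"
  shows "(\<Sum>s<3 * n. f s) = (\<Sum>p<n. f (3 * p) + f (Suc (3 * p)) + f (Suc (Suc (3 * p))))"
proof (induction n)
  case (Suc n)
  have "3 * Suc n = Suc (Suc (Suc (3 * n)))" by simp
  then show ?case using Suc by (simp only: sum.lessThan_Suc add.assoc)
qed simp

lemma sum_lessThan_add:
  fixes f :: "nat \<Rightarrow> 'a::comm_monoid_add"
  shows "(\<Sum>s<a + b. f s) = (\<Sum>s<a. f s) + (\<Sum>p<b. f (a + p))"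
  by (induction b) (simp_all add: add.assoc)

definition vector_part :: "real Matrix.vec \<Rightarrow> nat \<Rightarrow> real^3" where
  "vector_part x p = vector [vec_index x (3 * p), vec_index x (Suc (3 * p)), vec_index x (Suc (Suc (3 * p)))]"

definition scalar_part :: "nat \<Rightarrow> real Matrix.vec \<Rightarrow> nat \<Rightarrow> real" where
  "scalar_part n x p = vec_index x (3 * n + p)"

lemma vector_part_add:
  assumes "x \<in> carrier_vec (4 * n)" "y \<in> carrier_vec (4 * n)" "p < n"
  shows "vector_part (x + y) p = vector_part x p + vector_part y p"
    and "scalar_part n (x + y) p = scalar_part n x p + scalar_part n y p"
  using assms by (auto simp: vector_part_def scalar_part_def vec_eq_iff forall_3)

lemma vector_part_minus:
  assumes "x \<in> carrier_vec (4 * n)" "y \<in> carrier_vec (4 * n)" "p < n"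
  shows "vector_part (x - y) p = vector_part x p - vector_part y p"
    and "scalar_part n (x - y) p = scalar_part n x p - scalar_part n y p"
  using assms by (auto simp: vector_part_def scalar_part_def vec_eq_iff forall_3)

lemma vector_part_smult:
  assumes "x \<in> carrier_vec (4 * n)" "p < n"
  shows "vector_part (c \<cdot>\<^sub>v x) p = c *\<^sub>R vector_part x p"
    and "scalar_part n (c \<cdot>\<^sub>v x) p = c * scalar_part n x p"
  using assms by (auto simp: vector_part_def scalar_part_def vec_eq_iff forall_3)

lemma vector_part_zero:
  assumes "p < n"
  shows "vector_part (0\<^sub>v (4 * n)) p = 0" and "scalar_part n (0\<^sub>v (4 * n)) p = 0"
  using assms by (auto simp: vector_part_def scalar_part_def vec_eq_iff forall_3)

text \<open>The squared 2-norm is split into the shares of the two blocks, because the symmetric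
  Cayley transform \<open>Q\<close> damps only the first of them.\<close>

definition "vector_mass n x = (\<Sum>p<n. (norm (vector_part x p))\<^sup>2)"
definition "scalar_mass n x = (\<Sum>p<n. (scalar_part n x p)\<^sup>2)"

lemma vector_mass_nonneg: "0 \<le> vector_mass n x" and scalar_mass_nonneg: "0 \<le> scalar_mass n x"
  by (simp_all add: vector_mass_def scalar_mass_def sum_nonneg)

lemma norm_real3_sq: "(norm (v :: real^3))\<^sup>2 = (vec_nth v 1)\<^sup>2 + (vec_nth v 2)\<^sup>2 + (vec_nth v 3)\<^sup>2"
  unfolding power2_norm_eq_inner by (simp add: inner_vec_def sum_3 power2_eq_square)

lemma vector_mass_eq: "vector_mass n x = (\<Sum>s<3 * n. (vec_index x s)\<^sup>2)"
  unfolding vector_mass_def sum_lessThan_3_mult norm_real3_sq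
  by (simp add: vector_part_def)

lemma vec_norm_sq:
  assumes "x \<in> carrier_vec (4 * n)"
  shows "(vec_norm x)\<^sup>2 = vector_mass n x + scalar_mass n x"
proof -
  have dim: "dim_vec x = 3 * n + n" using assms by auto
  have "(vec_norm x)\<^sup>2 = (\<Sum>s<3 * n + n. (vec_index x s)\<^sup>2)"
    unfolding vec_norm_def L2_set_def dim by (simp add: sum_nonneg)
  also have "\<dots> = vector_mass n x + scalar_mass n x"
    unfolding vector_mass_eq scalar_mass_def scalar_part_def by (rule sum_lessThan_add)
  finally show ?thesis .
qed

lemma four_block_mult_vec_upper:
  assumes "A \<in> carrier_mat (3 * n) (3 * n)" "B \<in> carrier_mat (3 * n) n"
    "C \<in> carrier_mat n (3 * n)" "D \<in> carrier_mat n n" "x \<in> carrier_vec (4 * n)" "r < 3 * n"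
  shows "vec_index (four_block_mat A B C D *\<^sub>v x) r
    = (\<Sum>s<3 * n. A $$ (r, s) * vec_index x s) + (\<Sum>p<n. B $$ (r, p) * scalar_part n x p)"
proof -
  have "vec_index (four_block_mat A B C D *\<^sub>v x) r
      = (\<Sum>s<3 * n + n. four_block_mat A B C D $$ (r, s) * vec_index x s)"
    using assms by (auto simp: scalar_prod_def atLeast0LessThan intro!: sum.cong)
  also have "\<dots> = (\<Sum>s<3 * n. four_block_mat A B C D $$ (r, s) * vec_index x s)
      + (\<Sum>p<n. four_block_mat A B C D $$ (r, 3 * n + p) * scalar_part n x p)"
    unfolding scalar_part_def by (rule sum_lessThan_add)
  finally show ?thesis using assms by simp
qed

lemma four_block_mult_vec_lower:
  assumes "A \<in> carrier_mat (3 * n) (3 * n)" "B \<in> carrier_mat (3 * n) n"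
    "C \<in> carrier_mat n (3 * n)" "D \<in> carrier_mat n n" "x \<in> carrier_vec (4 * n)" "q < n"
  shows "scalar_part n (four_block_mat A B C D *\<^sub>v x) q
    = (\<Sum>s<3 * n. C $$ (q, s) * vec_index x s) + (\<Sum>p<n. D $$ (q, p) * scalar_part n x p)"
proof -
  have "scalar_part n (four_block_mat A B C D *\<^sub>v x) q
      = (\<Sum>s<3 * n + n. four_block_mat A B C D $$ (3 * n + q, s) * vec_index x s)"
    using assms by (auto simp: scalar_prod_def scalar_part_def atLeast0LessThan intro!: sum.cong)
  also have "\<dots> = (\<Sum>s<3 * n. four_block_mat A B C D $$ (3 * n + q, s) * vec_index x s)
      + (\<Sum>p<n. four_block_mat A B C D $$ (3 * n + q, 3 * n + p) * scalar_part n x p)"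
    unfolding scalar_part_def by (rule sum_lessThan_add)
  finally show ?thesis using assms by simp
qed

section \<open>Nodal action of the skew and the symmetric part\<close>

definition skew_mat :: "nat \<Rightarrow> (nat \<Rightarrow> real^3) \<Rightarrow> real mat" where
  "skew_mat n m = four_block_mat (S_mat n m) (transpose_mat (B_mat n m)) (- B_mat n m) (0\<^sub>m n n)"

definition sym_mat :: "nat \<Rightarrow> real mat \<Rightarrow> real mat" where
  "sym_mat n H = four_block_mat H (0\<^sub>m (3 * n) n) (0\<^sub>m n (3 * n)) (0\<^sub>m n n)"

lemma S_mat_carrier [simp]: "S_mat n m \<in> carrier_mat (3 * n) (3 * n)"
  and B_mat_carrier [simp]: "B_mat n m \<in> carrier_mat n (3 * n)"
  by (simp_all add: S_mat_def B_mat_def)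

lemma skew_mat_carrier [simp]: "skew_mat n m \<in> carrier_mat (4 * n) (4 * n)"
  unfolding skew_mat_def by (rule carrier_matI) (auto simp: S_mat_def)

lemma sym_mat_carrier [simp]: "H \<in> carrier_mat (3 * n) (3 * n) \<Longrightarrow> sym_mat n H \<in> carrier_mat (4 * n) (4 * n)"
  unfolding sym_mat_def by (rule carrier_matI) auto

text \<open>Only the three columns belonging to the node of row \<open>r\<close> survive, and the
  cross product is linear in its second factor.\<close>

lemma S_mat_row_sum:
  assumes "r < 3 * n"
  shows "(\<Sum>s<3 * n. S_mat n m $$ (r, s) * vec_index x s)
    = vec_nth (cross3 (m (r div 3)) (vector_part x (r div 3))) (component r)"
proof -
  let ?p = "r div 3"
  let ?t = "\<lambda>c s. vec_nth (cross3 (m ?p) (axis c 1)) (component r) * vec_index x s"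
  have div: "3 * p div 3 = p" "Suc (3 * p) div 3 = p" "Suc (Suc (3 * p)) div 3 = p" for p :: nat
    by presburger+
  have "(\<Sum>s<3 * n. S_mat n m $$ (r, s) * vec_index x s)
      = (\<Sum>s<3 * n. if ?p = s div 3 then ?t (component s) s else 0)"
    using assms by (intro sum.cong) (auto simp: S_mat_def)
  also have "\<dots> = (\<Sum>p<n. if ?p = p then ?t 1 (3 * p) + ?t 2 (Suc (3 * p)) + ?t 3 (Suc (Suc (3 * p))) else 0)"
    unfolding sum_lessThan_3_mult div by (intro sum.cong) auto
  also have "\<dots> = ?t 1 (3 * ?p) + ?t 2 (Suc (3 * ?p)) + ?t 3 (Suc (Suc (3 * ?p)))"
    using assms by (simp add: less_mult_imp_div_less)
  also have "\<dots> = vec_nth (cross3 (m ?p) (vector_part x ?p)) (component r)"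
    using exhaust_3[of "component r"]
    by (auto simp: cross3_def axis_def vector_part_def algebra_simps)
  finally show ?thesis .
qed

lemma B_mat_row_sum:
  assumes "q < n"
  shows "(\<Sum>s<3 * n. B_mat n m $$ (q, s) * vec_index x s) = m q \<bullet> vector_part x q"
proof -
  let ?t = "\<lambda>c s. vec_nth (m q) c * vec_index x s"
  have div: "3 * p div 3 = p" "Suc (3 * p) div 3 = p" "Suc (Suc (3 * p)) div 3 = p" for p :: nat
    by presburger+
  have "(\<Sum>s<3 * n. B_mat n m $$ (q, s) * vec_index x s)
      = (\<Sum>s<3 * n. if s div 3 = q then ?t (component s) s else 0)"
    using assms by (intro sum.cong) (auto simp: B_mat_def)
  also have "\<dots> = (\<Sum>p<n. if p = q then ?t 1 (3 * p) + ?t 2 (Suc (3 * p)) + ?t 3 (Suc (Suc (3 * p))) else 0)"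
    unfolding sum_lessThan_3_mult div by (intro sum.cong) auto
  also have "\<dots> = m q \<bullet> vector_part x q"
    using assms by (simp add: inner_vec_def sum_3 vector_part_def)
  finally show ?thesis .
qed

text \<open>With \<open>scalar_part_skew\<close> this decouples \<open>skew_mat\<close> into one 4
  by 4 block per node, so that its properties reduce to vector algebra in
  \<open>real^3\<close>.\<close>

lemma vector_part_skew:
  assumes x: "x \<in> carrier_vec (4 * n)" and p: "p < n"
  shows "vector_part (skew_mat n m *\<^sub>v x) p = cross3 (m p) (vector_part x p) + scalar_part n x p *\<^sub>R m p"
proof -
  have idx: "vec_index (skew_mat n m *\<^sub>v x) r
      = vec_nth (cross3 (m p) (vector_part x p) + scalar_part n x p *\<^sub>R m p) (component r)"
    if r: "r < 3 * n" "r div 3 = p" for r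
  proof -
    have "(\<Sum>q<n. transpose_mat (B_mat n m) $$ (r, q) * scalar_part n x q)
        = (\<Sum>q<n. if q = p then vec_nth (m p) (component r) * scalar_part n x p else 0)"
      using r by (intro sum.cong) (auto simp: B_mat_def)
    then show ?thesis
      unfolding skew_mat_def using p r(2)
      by (subst four_block_mult_vec_upper[OF _ _ _ _ x r(1)]) (auto simp: S_mat_row_sum[OF r(1)])
  qed
  have "3 * p < 3 * n" "Suc (3 * p) < 3 * n" "Suc (Suc (3 * p)) < 3 * n"
    and "3 * p div 3 = p" "Suc (3 * p) div 3 = p" "Suc (Suc (3 * p)) div 3 = p"
    using p by presburger+
  then show ?thesis
    unfolding vector_part_def[of "skew_mat n m *\<^sub>v x"] using idx by (auto simp: vec_eq_iff forall_3)
qed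

lemma scalar_part_skew:
  assumes x: "x \<in> carrier_vec (4 * n)" and p: "p < n"
  shows "scalar_part n (skew_mat n m *\<^sub>v x) p = - (m p \<bullet> vector_part x p)"
proof -
  have "(\<Sum>s<3 * n. (- B_mat n m) $$ (p, s) * vec_index x s) = - (\<Sum>s<3 * n. B_mat n m $$ (p, s) * vec_index x s)"
    using p B_mat_carrier[of n m]
    by (auto simp: sum_negf[symmetric] simp del: B_mat_carrier intro!: sum.cong)
  then show ?thesis
    unfolding skew_mat_def using p
    by (subst four_block_mult_vec_lower[OF _ _ _ _ x p]) (auto simp: B_mat_row_sum)
qed

lemma sym_mat_upper:
  assumes "H \<in> carrier_mat (3 * n) (3 * n)" "x \<in> carrier_vec (4 * n)" "r < 3 * n"
  shows "vec_index (sym_mat n H *\<^sub>v x) r = (\<Sum>s<3 * n. H $$ (r, s) * vec_index x s)"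
  unfolding sym_mat_def using assms
  by (subst four_block_mult_vec_upper[OF assms(1) _ _ _ assms(2,3)]) auto

lemma scalar_part_sym:
  assumes "H \<in> carrier_mat (3 * n) (3 * n)" "x \<in> carrier_vec (4 * n)" "p < n"
  shows "scalar_part n (sym_mat n H *\<^sub>v x) p = 0"
  unfolding sym_mat_def using assms
  by (subst four_block_mult_vec_lower[OF assms(1) _ _ _ assms(2,3)]) auto

text \<open>Read \<open>(a, s)\<close> as the quaternion with vector part \<open>a\<close> and real
  part \<open>s\<close>. The nodal block of \<open>skew_mat\<close> is left multiplication by the
  pure quaternion \<open>m\<close>, so the shifted block is left multiplication by
  \<open>l + m\<close>, and the quaternion norm is multiplicative. The next lemma is the same fact
  for \<open>l - m\<close>.\<close>

lemma node_norm_plus: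
  fixes m a :: "real^3" and l s :: real
  shows "(norm (l *\<^sub>R a + (cross3 m a + s *\<^sub>R m)))\<^sup>2 + (l * s + - (m \<bullet> a))\<^sup>2
    = (l\<^sup>2 + (norm m)\<^sup>2) * ((norm a)\<^sup>2 + s\<^sup>2)"
  unfolding power2_norm_eq_inner
  by (simp add: inner_vec_def sum_3 cross3_def power2_eq_square algebra_simps)

lemma node_norm_minus:
  fixes m a :: "real^3" and l s :: real
  shows "(norm (l *\<^sub>R a - (cross3 m a + s *\<^sub>R m)))\<^sup>2 + (l * s - - (m \<bullet> a))\<^sup>2
    = (l\<^sup>2 + (norm m)\<^sup>2) * ((norm a)\<^sup>2 + s\<^sup>2)"
  unfolding power2_norm_eq_inner
  by (simp add: inner_vec_def sum_3 cross3_def power2_eq_square algebra_simps)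

text \<open>In quaternion terms \<open>V\<close> multiplies by
  \<open>(l - m) (l + m)^(-1) = (l - m)^2 / D\<close>, whose pure part is
  \<open>- 2 l m / D\<close>. It sends the scalar part \<open>t\<close> of the input to a vector of
  length \<open>2 l |m| |t| / D\<close>, and in the output \<open>z\<close> this vector can be
  cancelled only by the contribution of \<open>u\<close>.\<close>

lemma node_coupling:
  fixes m a :: "real^3" and l s :: real
  assumes "l > 0"
  defines "u \<equiv> l *\<^sub>R a + (cross3 m a + s *\<^sub>R m)" and "t \<equiv> l * s + - (m \<bullet> a)"
    and "z \<equiv> l *\<^sub>R a - (cross3 m a + s *\<^sub>R m)"
  shows "2 * l * norm m / (l\<^sup>2 + (norm m)\<^sup>2) * \<bar>t\<bar> \<le> norm z + norm u"
proof -
  define D where "D = l\<^sup>2 + (norm m)\<^sup>2"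
  \<comment> \<open>\<open>y\<close> is \<open>D\<close> times the contribution of \<open>u\<close>
    to \<open>z\<close>, read off from \<open>(l - m)^2 = l^2 - |m|^2 - 2 l m\<close>.\<close>
  define y where "y = (l\<^sup>2 - (norm m)\<^sup>2) *\<^sub>R u - (2 * l) *\<^sub>R cross3 m u"
  have D: "D > 0" using assms by (simp add: D_def add_pos_nonneg)
  have "D *\<^sub>R z = y - (2 * l * t) *\<^sub>R m"
    unfolding y_def u_def t_def z_def D_def power2_norm_eq_inner
    by (simp add: vec_eq_iff forall_3 cross3_def inner_vec_def sum_3 power2_eq_square algebra_simps)
  then have "(2 * l * t) *\<^sub>R m = y - D *\<^sub>R z" by simp
  then have "norm ((2 * l * t) *\<^sub>R m) \<le> norm y + D * norm z"
    using norm_triangle_ineq4[of y "D *\<^sub>R z"] D by simp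
  \<comment> \<open>\<open>u\<close> is orthogonal to \<open>cross3 m u\<close>, so the squares of
    the two terms of \<open>y\<close> add, and
    \<open>(l^2 - |m|^2)^2 + 4 l^2 |m|^2 = D^2\<close>.\<close>
  moreover have "norm y \<le> D * norm u"
  proof (rule power2_le_imp_le)
    have "(norm (cross3 m u))\<^sup>2 \<le> (norm m)\<^sup>2 * (norm u)\<^sup>2"
      unfolding power2_norm_eq_inner dot_cross by (simp add: inner_commute)
    then have "4 * l\<^sup>2 * (norm (cross3 m u))\<^sup>2 \<le> 4 * l\<^sup>2 * ((norm m)\<^sup>2 * (norm u)\<^sup>2)"
      by (intro mult_left_mono) auto
    moreover have "(norm y)\<^sup>2 = (l\<^sup>2 - (norm m)\<^sup>2)\<^sup>2 * (norm u)\<^sup>2 + 4 * l\<^sup>2 * (norm (cross3 m u))\<^sup>2"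
      unfolding y_def power2_norm_eq_inner
      by (simp add: inner_diff_left inner_diff_right dot_cross_self power2_eq_square algebra_simps)
    moreover have "(l\<^sup>2 - (norm m)\<^sup>2)\<^sup>2 * (norm u)\<^sup>2 + 4 * l\<^sup>2 * ((norm m)\<^sup>2 * (norm u)\<^sup>2) = (D * norm u)\<^sup>2"
      by (simp add: D_def power2_eq_square algebra_simps)
    ultimately show "(norm y)\<^sup>2 \<le> (D * norm u)\<^sup>2" by linarith
  qed (use D in simp)
  ultimately show ?thesis
    using D assms(1) by (simp add: D_def[symmetric] abs_mult field_simps)
qed

section \<open>The Fourier multiplier\<close>

text \<open>The scalar Cayley transform \<open>(lam - t) / (lam + t)\<close> decreases in
  \<open>t > 0\<close>, so its modulus on an interval is largest at an endpoint.\<close>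

lemma cayley_bound:
  fixes lam :: real
  assumes "lam > 0" "0 < a" "a \<le> t" "t \<le> b"
  shows "\<bar>lam - t\<bar> \<le> max \<bar>(lam - a) / (lam + a)\<bar> \<bar>(lam - b) / (lam + b)\<bar> * (lam + t)"
proof -
  have "(lam - t) / (lam + t) \<le> (lam - a) / (lam + a)" "(lam - b) / (lam + b) \<le> (lam - t) / (lam + t)"
    using assms by (simp_all add: field_simps)
  then have "\<bar>(lam - t) / (lam + t)\<bar> \<le> max \<bar>(lam - a) / (lam + a)\<bar> \<bar>(lam - b) / (lam + b)\<bar>"
    by linarith
  then show ?thesis
    using assms by (simp add: abs_divide pos_divide_le_eq)
qed

context periodic_grid
begin

lemma H_mat_carrier [simp]: "H_mat d L N \<nu> F \<alpha> \<theta> k C \<in> carrier_mat (3 * n) (3 * n)"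
  by (simp add: H_mat_def neg_laplacian_mat_def)

text \<open>The columns of \<open>neg_laplacian_mat\<close> are images of unit grid functions;
  linearity recovers the operator from them.\<close>

lemma lap_expand: "lap u p = (\<Sum>q<n. u q * lap (\<lambda>r. if r = q then 1 else 0) p)"
proof -
  have delta: "hat (\<lambda>r. if r = q then 1 else 0) \<kappa> = mode' \<kappa> q / of_nat n" if "q < n" for \<kappa> q
    unfolding fourier_coeff_def using that by (simp add: if_distrib[of "\<lambda>x. x * _"] cong: if_cong)
  have "lap u p = (\<Sum>\<kappa>\<in>F. \<Sum>q<n. u q * (of_real (symb \<kappa>) * (mode' \<kappa> q / of_nat n) * mode \<kappa> p))"
    unfolding neg_laplacian_def symb_def[symmetric] fourier_coeff_def
    by (simp add: sum_distrib_left sum_distrib_right sum_divide_distrib mult_ac)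
  also have "\<dots> = (\<Sum>q<n. u q * lap (\<lambda>r. if r = q then 1 else 0) p)"
    by (subst sum.swap) (simp add: neg_laplacian_def symb_def[symmetric] delta sum_distrib_left)
  finally show ?thesis .
qed

text \<open>Removes the \<open>Re\<close> in \<open>neg_laplacian_mat\<close>, whose argument is
  real by \<open>neg_laplacian_real\<close>.\<close>

lemma lap_delta_real:
  "complex_of_real (Re (lap (\<lambda>r. if r = q then 1 else 0) p)) = lap (\<lambda>r. if r = q then 1 else 0) p"
proof -
  have "lap (\<lambda>r. of_real (if r = q then 1 else 0)) p \<in> \<real>"
    using L N F by (intro neg_laplacian_real)
  then show ?thesis by (simp add: if_distrib of_real_Re cong: if_cong)
qed

text \<open>Stated for complex \<open>f\<close>, because the spectral argument below uses complex
  eigenvectors. Rows of component \<open>c\<close> meet only columns of component \<open>c\<close>,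
  so \<open>H\<close> acts on three separate scalar grid functions.\<close>

lemma H_mat_row_sum:
  assumes "c < 3" "p < n"
  shows "(\<Sum>s<3 * n. complex_of_real (H_mat d L N \<nu> F \<alpha> \<theta> k C $$ (3 * p + c, s)) * f s)
    = of_real \<alpha> * f (3 * p + c) + of_real (\<theta> * k * C) * lap (\<lambda>q. f (3 * q + c)) p"
proof -
  let ?r = "3 * p + c" and ?\<delta> = "\<lambda>q r. if r = q then 1 else (0::complex)"
  have r: "?r < 3 * n" "?r div 3 = p" "?r mod 3 = c" using assms by auto
  have div: "3 * p div 3 = p" "Suc (3 * p) div 3 = p" "Suc (Suc (3 * p)) div 3 = p"
     "3 * p mod 3 = 0" "Suc (3 * p) mod 3 = 1" "Suc (Suc (3 * p)) mod 3 = 2" for p :: nat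
    by presburger+
  have "(\<Sum>s<3 * n. complex_of_real (H_mat d L N \<nu> F \<alpha> \<theta> k C $$ (?r, s)) * f s)
    = (\<Sum>s<3 * n. (if ?r = s then of_real \<alpha> * f s else 0)
        + of_real (\<theta> * k * C) * (if c = s mod 3 then lap (?\<delta> (s div 3)) p * f s else 0))"
  proof (rule sum.cong[OF refl])
    fix s assume "s \<in> {..<3 * n}"
    then show "complex_of_real (H_mat d L N \<nu> F \<alpha> \<theta> k C $$ (?r, s)) * f s
      = (if ?r = s then of_real \<alpha> * f s else 0)
        + of_real (\<theta> * k * C) * (if c = s mod 3 then lap (?\<delta> (s div 3)) p * f s else 0)"
      using r by (auto simp: lap_delta_real[of "s div 3" p] H_mat_def neg_laplacian_mat_def component_eq_iff ring_distribs)
  qed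
  also have "\<dots> = of_real \<alpha> * f ?r
      + of_real (\<theta> * k * C) * (\<Sum>s<3 * n. if c = s mod 3 then lap (?\<delta> (s div 3)) p * f s else 0)"
    using r(1) by (simp add: sum.distrib sum_distrib_left)
  also have "(\<Sum>s<3 * n. if c = s mod 3 then lap (?\<delta> (s div 3)) p * f s else 0)
      = (\<Sum>q<n. f (3 * q + c) * lap (?\<delta> q) p)"
  proof -
    consider "c = 0" | "c = 1" | "c = 2" using assms(1) by linarith
    then show ?thesis unfolding sum_lessThan_3_mult div by cases (simp_all add: mult.commute)
  qed
  also have "\<dots> = lap (\<lambda>q. f (3 * q + c)) p"
    by (rule lap_expand[symmetric])
  finally show ?thesis .
qed

text \<open>The hypothesis \<open>eq\<close> expresses \<open>x = Qy\<close> without an inverse. In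
  Fourier space it reads \<open>(lam + h) * hat x = (lam - h) * hat y\<close> with \<open>h\<close>
  the symbol of \<open>H\<close>; each mode is damped by \<open>q\<close>, and Parseval carries this
  to the vector mass. On the scalar block \<open>sym_mat\<close> vanishes, so \<open>Q\<close> is
  the identity there.\<close>

lemma cayley_contraction:
  fixes \<alpha> \<theta> k C lam q :: real
  defines "H \<equiv> H_mat d L N \<nu> F \<alpha> \<theta> k C"
  assumes pos: "\<And>\<kappa>. \<kappa> \<in> F \<Longrightarrow> 0 < lam + (\<alpha> + \<theta> * k * C * symb \<kappa>)"
    and q: "\<And>\<kappa>. \<kappa> \<in> F \<Longrightarrow>
      \<bar>lam - (\<alpha> + \<theta> * k * C * symb \<kappa>)\<bar> \<le> q * (lam + (\<alpha> + \<theta> * k * C * symb \<kappa>))"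
    and lam: "lam \<noteq> 0"
    and x: "x \<in> carrier_vec (4 * n)" and y: "y \<in> carrier_vec (4 * n)"
    and eq: "lam \<cdot>\<^sub>v x + sym_mat n H *\<^sub>v x = lam \<cdot>\<^sub>v y - sym_mat n H *\<^sub>v y"
  shows "vector_mass n x \<le> q\<^sup>2 * vector_mass n y" and "scalar_mass n x = scalar_mass n y"
proof -
  have H: "H \<in> carrier_mat (3 * n) (3 * n)" by (simp add: H_def)
  have S: "sym_mat n H *\<^sub>v v \<in> carrier_vec (4 * n)" for v
    by (rule carrier_vecI) (simp add: carrier_matD(1)[OF sym_mat_carrier[OF H]])
  show "scalar_mass n x = scalar_mass n y"
    unfolding scalar_mass_def
  proof (intro sum.cong refl)
    fix p assume "p \<in> {..<n}"
    then have p: "p < n" by simp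
    have "scalar_part n (lam \<cdot>\<^sub>v x + sym_mat n H *\<^sub>v x) p = scalar_part n (lam \<cdot>\<^sub>v y - sym_mat n H *\<^sub>v y) p"
      using eq by simp
    then have "lam * scalar_part n x p = lam * scalar_part n y p"
      using x y S p H by (simp add: vector_part_add vector_part_minus vector_part_smult scalar_part_sym)
    then show "(scalar_part n x p)\<^sup>2 = (scalar_part n y p)\<^sup>2" using lam by simp
  qed
  \<comment> \<open>Each Cartesian component of the vector block is one complex grid function, to
    which the Fourier lemmas apply.\<close>
  let ?g = "\<lambda>v c p. complex_of_real (vec_index v (3 * p + c))"
  have comp: "(\<Sum>p<n. (cmod (?g x c p))\<^sup>2) \<le> q\<^sup>2 * (\<Sum>p<n. (cmod (?g y c p))\<^sup>2)" if c: "c < 3" for c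
  proof -
    have Hrow: "complex_of_real (vec_index (sym_mat n H *\<^sub>v v) (3 * p + c))
        = of_real \<alpha> * ?g v c p + of_real (\<theta> * k * C) * lap (?g v c) p"
      if "p < n" "v \<in> carrier_vec (4 * n)" for v p
    proof -
      have "3 * p + c < 3 * n" using that c by linarith
      then show ?thesis
        using that c H by (simp add: sym_mat_upper H_def H_mat_row_sum flip: of_real_mult)
          (simp add: H_mat_row_sum[where f="\<lambda>s. complex_of_real (vec_index v s)"])
    qed
    have pt: "of_real (lam + \<alpha>) * ?g x c p + of_real (\<theta> * k * C) * lap (?g x c) p
        = of_real (lam - \<alpha>) * ?g y c p + of_real (- (\<theta> * k * C)) * lap (?g y c) p" if p: "p < n" for p
    proof -
      have idx: "vec_index (lam \<cdot>\<^sub>v v + w) (3 * p + c) = lam * vec_index v (3 * p + c) + vec_index w (3 * p + c)"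
          "vec_index (lam \<cdot>\<^sub>v v - w) (3 * p + c) = lam * vec_index v (3 * p + c) - vec_index w (3 * p + c)"
        if "v \<in> carrier_vec (4 * n)" "w \<in> carrier_vec (4 * n)" for v w
        using that p c by auto
      have "vec_index (lam \<cdot>\<^sub>v x + sym_mat n H *\<^sub>v x) (3 * p + c)
          = vec_index (lam \<cdot>\<^sub>v y - sym_mat n H *\<^sub>v y) (3 * p + c)"
        using eq by simp
      then have "lam * vec_index x (3 * p + c) + vec_index (sym_mat n H *\<^sub>v x) (3 * p + c)
          = lam * vec_index y (3 * p + c) - vec_index (sym_mat n H *\<^sub>v y) (3 * p + c)"
        using idx[OF x S] idx[OF y S] by simp
      then have "of_real lam * ?g x c p + complex_of_real (vec_index (sym_mat n H *\<^sub>v x) (3 * p + c))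
          = of_real lam * ?g y c p - complex_of_real (vec_index (sym_mat n H *\<^sub>v y) (3 * p + c))"
        by (metis of_real_add of_real_diff of_real_mult)
      then show ?thesis
        unfolding Hrow[OF p x] Hrow[OF p y] by (simp add: algebra_simps)
    qed
    have hat_le: "(cmod (hat (?g x c) \<kappa>))\<^sup>2 \<le> q\<^sup>2 * (cmod (hat (?g y c) \<kappa>))\<^sup>2" if \<kappa>: "\<kappa> \<in> F" for \<kappa>
    proof -
      let ?h = "\<alpha> + \<theta> * k * C * symb \<kappa>"
      have "hat (\<lambda>p. of_real (lam + \<alpha>) * ?g x c p + of_real (\<theta> * k * C) * lap (?g x c) p) \<kappa>
          = hat (\<lambda>p. of_real (lam - \<alpha>) * ?g y c p + of_real (- (\<theta> * k * C)) * lap (?g y c) p) \<kappa>"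
        by (rule fun_cong[OF hat_cong]) (rule pt)
      then have "of_real (lam + ?h) * hat (?g x c) \<kappa> = of_real (lam - ?h) * hat (?g y c) \<kappa>"
        unfolding hat_linear hat_lap[OF \<kappa>] by (simp add: algebra_simps)
      then have "cmod (of_real (lam + ?h) * hat (?g x c) \<kappa>) = cmod (of_real (lam - ?h) * hat (?g y c) \<kappa>)"
        by simp
      then have "(lam + ?h) * cmod (hat (?g x c) \<kappa>) = \<bar>lam - ?h\<bar> * cmod (hat (?g y c) \<kappa>)"
        using pos[OF \<kappa>] by (simp only: norm_mult norm_of_real abs_of_pos)
      also have "\<dots> \<le> (lam + ?h) * (q * cmod (hat (?g y c) \<kappa>))"
        using mult_right_mono[OF q[OF \<kappa>], of "cmod (hat (?g y c) \<kappa>)"] by (simp add: mult_ac)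
      finally have "cmod (hat (?g x c) \<kappa>) \<le> q * cmod (hat (?g y c) \<kappa>)"
        using pos[OF \<kappa>] by (simp add: mult_le_cancel_left)
      then have "(cmod (hat (?g x c) \<kappa>))\<^sup>2 \<le> (q * cmod (hat (?g y c) \<kappa>))\<^sup>2"
        by (rule power_mono) simp
      then show ?thesis by (simp add: power_mult_distrib)
    qed
    have "(\<Sum>\<kappa>\<in>F. (cmod (hat (?g x c) \<kappa>))\<^sup>2) \<le> q\<^sup>2 * (\<Sum>\<kappa>\<in>F. (cmod (hat (?g y c) \<kappa>))\<^sup>2)"
      unfolding sum_distrib_left by (intro sum_mono hat_le)
    then show ?thesis
      unfolding parseval_norm by (simp add: mult.left_commute mult_left_mono)
  qed
  have mass: "vector_mass n v = (\<Sum>p<n. (cmod (?g v 0 p))\<^sup>2) + (\<Sum>p<n. (cmod (?g v 1 p))\<^sup>2)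
      + (\<Sum>p<n. (cmod (?g v 2 p))\<^sup>2)" for v
    unfolding vector_mass_eq sum_lessThan_3_mult by (simp add: sum.distrib)
  show "vector_mass n x \<le> q\<^sup>2 * vector_mass n y"
    unfolding mass using comp[of 0] comp[of 1] comp[of 2] by (simp add: ring_distribs)
qed

text \<open>By Parseval the form is, for each component, a sum of squared moduli of Fourier
  coefficients weighted by the symbol of \<open>H\<close>, which lies between \<open>a\<close> and
  \<open>b\<close>. The real value \<open>t\<close> is what later shows that the eigenvalues are
  real.\<close>

lemma H_mat_quadratic_form:
  fixes \<alpha> \<theta> k C a b :: real and f :: "nat \<Rightarrow> complex"
  defines "H \<equiv> H_mat d L N \<nu> F \<alpha> \<theta> k C"
  assumes bounds: "\<And>\<kappa>. \<kappa> \<in> F \<Longrightarrow> a \<le> \<alpha> + \<theta> * k * C * symb \<kappa> \<and> \<alpha> + \<theta> * k * C * symb \<kappa> \<le> b"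
  obtains t where "(\<Sum>r<3 * n. cnj (f r) * (\<Sum>s<3 * n. complex_of_real (H $$ (r, s)) * f s)) = of_real t"
    and "a * (\<Sum>r<3 * n. (cmod (f r))\<^sup>2) \<le> t" and "t \<le> b * (\<Sum>r<3 * n. (cmod (f r))\<^sup>2)"
proof -
  let ?h = "\<lambda>\<kappa>. \<alpha> + \<theta> * k * C * symb \<kappa>" and ?g = "\<lambda>c p. f (3 * p + c)"
  define t where "t c = of_nat n * (\<Sum>\<kappa>\<in>F. ?h \<kappa> * (cmod (hat (?g c) \<kappa>))\<^sup>2)" for c
  have sq: "cnj z * z = of_real ((cmod z)\<^sup>2)" for z
    using complex_norm_square[of z] by (simp add: mult.commute)
  have form: "(\<Sum>p<n. cnj (?g c p) * (\<Sum>s<3 * n. complex_of_real (H $$ (3 * p + c, s)) * f s)) = of_real (t c)"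
    if c: "c < 3" for c
  proof -
    have "(\<Sum>p<n. cnj (?g c p) * (\<Sum>s<3 * n. complex_of_real (H $$ (3 * p + c, s)) * f s))
        = (\<Sum>p<n. cnj (?g c p) * (of_real \<alpha> * ?g c p + of_real (\<theta> * k * C) * lap (?g c) p))"
      unfolding H_def using c by (intro sum.cong) (auto simp: H_mat_row_sum)
    also have "\<dots> = of_nat n * (\<Sum>\<kappa>\<in>F. cnj (hat (?g c) \<kappa>) * (of_real (?h \<kappa>) * hat (?g c) \<kappa>))"
      unfolding parseval hat_linear by (simp add: hat_lap algebra_simps cong: sum.cong)
    also have "\<dots> = of_nat n * (\<Sum>\<kappa>\<in>F. of_real (?h \<kappa>) * (cnj (hat (?g c) \<kappa>) * hat (?g c) \<kappa>))"
      by (simp add: mult_ac)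
    also have "\<dots> = of_real (t c)"
      unfolding sq t_def by simp
    finally show ?thesis .
  qed
  have lo: "a * (\<Sum>p<n. (cmod (?g c p))\<^sup>2) \<le> t c" and hi: "t c \<le> b * (\<Sum>p<n. (cmod (?g c p))\<^sup>2)" for c
    unfolding parseval_norm t_def mult.left_commute[of _ "of_nat n"] unfolding sum_distrib_left
    using bounds by (auto intro!: mult_left_mono sum_mono mult_right_mono)
  show thesis
  proof (rule that)
    show "(\<Sum>r<3 * n. cnj (f r) * (\<Sum>s<3 * n. complex_of_real (H $$ (r, s)) * f s)) = of_real (t 0 + t 1 + t 2)"
      unfolding sum_lessThan_3_mult[of _ n] sum.distrib
      using form[of 0] form[of 1] form[of 2] unfolding sum_lessThan_3_mult[of _ n] sum.distrib by simp
    show "a * (\<Sum>r<3 * n. (cmod (f r))\<^sup>2) \<le> t 0 + t 1 + t 2" "t 0 + t 1 + t 2 \<le> b * (\<Sum>r<3 * n. (cmod (f r))\<^sup>2)"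
      unfolding sum_lessThan_3_mult sum.distrib
      using lo[of 0] lo[of 1] lo[of 2] hi[of 0] hi[of 1] hi[of 2] by (simp_all add: ring_distribs)
  qed
qed

text \<open>A Rayleigh quotient argument: for an eigenvector \<open>w\<close> and
  \<open>u = Z w\<close>, orthonormality of the columns makes the form of \<open>H\<close> at
  \<open>u\<close> equal to \<mu> times the squared norm of \<open>u\<close>.\<close>

lemma projected_spectrum:
  fixes \<alpha> \<theta> k C a b :: real and Z :: "real mat"
  defines "H \<equiv> H_mat d L N \<nu> F \<alpha> \<theta> k C"
  assumes bounds: "\<And>\<kappa>. \<kappa> \<in> F \<Longrightarrow> a \<le> \<alpha> + \<theta> * k * C * symb \<kappa> \<and> \<alpha> + \<theta> * k * C * symb \<kappa> \<le> b"
    and Z: "Z \<in> carrier_mat (3 * n) l" and orth: "transpose_mat Z * Z = 1\<^sub>m l"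
    and \<mu>: "\<mu> \<in> spectrum (map_mat complex_of_real (transpose_mat Z * H * Z))"
  shows "\<exists>t. \<mu> = of_real t \<and> a \<le> t \<and> t \<le> b"
proof -
  have H: "H \<in> carrier_mat (3 * n) (3 * n)" by (simp add: H_def)
  let ?c = "map_mat complex_of_real"
  let ?Zt = "transpose_mat (?c Z)"
  have Zc: "?c Z \<in> carrier_mat (3 * n) l" and Hc: "?c H \<in> carrier_mat (3 * n) (3 * n)"
    and Zt: "?Zt \<in> carrier_mat l (3 * n)"
    using Z H by auto
  have Zt': "transpose_mat Z \<in> carrier_mat l (3 * n)" and ZtH: "transpose_mat Z * H \<in> carrier_mat l (3 * n)"
    using Z H by auto
  have Ht: "?c (transpose_mat Z * H * Z) = ?Zt * ?c H * ?c Z"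
    by (simp only: of_real_hom.mat_hom_mult[OF ZtH Z] of_real_hom.mat_hom_mult[OF Zt' H] map_mat_transpose)
  have orthc: "?Zt * ?c Z = 1\<^sub>m l"
    using arg_cong[OF orth, of ?c]
    by (simp only: of_real_hom.mat_hom_mult[OF Zt' Z] of_real_hom.mat_hom_one map_mat_transpose)
  obtain w where w: "w \<in> carrier_vec l" "w \<noteq> 0\<^sub>v l" and ev: "(?Zt * ?c H * ?c Z) *\<^sub>v w = \<mu> \<cdot>\<^sub>v w"
    using \<mu> Z unfolding spectrum_def eigenvalue_def eigenvector_def Ht by auto
  define u where "u = ?c Z *\<^sub>v w"
  \<comment> \<open>The scalar product of vectors is bilinear, so the conjugation is put in by hand;
    as \<open>Z\<close> is real, \<open>u'\<close> is the conjugate of \<open>u\<close>.\<close>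
  define w' where "w' = map_vec cnj w"
  define u' where "u' = ?c Z *\<^sub>v w'"
  have car: "u \<in> carrier_vec (3 * n)" "u' \<in> carrier_vec (3 * n)" "w' \<in> carrier_vec l"
    using Zc w by (auto simp: u_def u'_def w'_def)
  have u': "vec_index u' r = cnj (vec_index u r)" if "r < 3 * n" for r
    using that Z w by (simp add: u_def u'_def w'_def scalar_prod_def cnj_sum)
  have "?Zt *\<^sub>v u = w"
    using w Zc Zt unfolding u_def by (subst assoc_mult_mat_vec[symmetric]) (auto simp: orthc)
  moreover have "?Zt *\<^sub>v (?c H *\<^sub>v u) = \<mu> \<cdot>\<^sub>v w"
    unfolding u_def ev[symmetric] using w Zc Zt Hc
    by (simp add: assoc_mult_mat_vec[of _ l "3 * n" _ l] assoc_mult_mat_vec[of _ "3 * n" "3 * n" _ l]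
        assoc_mult_mat[of _ l "3 * n" _ "3 * n" _ l])
  moreover have dual: "v \<bullet> u' = (?Zt *\<^sub>v v) \<bullet> w'" if "v \<in> carrier_vec (3 * n)" for v
    unfolding u'_def using that Zc car by (simp add: transpose_vec_mult_scalar)
  moreover have "?c H *\<^sub>v u \<in> carrier_vec (3 * n)"
    by (rule mult_mat_vec_carrier[OF Hc car(1)])
  ultimately have "(?c H *\<^sub>v u) \<bullet> u' = (\<mu> \<cdot>\<^sub>v w) \<bullet> w'" "u \<bullet> u' = w \<bullet> w'"
    using car by auto
  then have key: "(?c H *\<^sub>v u) \<bullet> u' = \<mu> * (u \<bullet> u')"
    using w car by simp
  define f where "f = vec_index u"
  have sq: "z * cnj z = of_real ((cmod z)\<^sup>2)" for z
    by (rule complex_norm_square[symmetric])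
  have "u \<bullet> u' = (\<Sum>r<3 * n. f r * cnj (f r))"
    using car by (auto simp: scalar_prod_def u' f_def atLeast0LessThan intro!: sum.cong)
  then have uu: "u \<bullet> u' = of_real (\<Sum>r<3 * n. (cmod (f r))\<^sup>2)"
    unfolding sq by simp
  have Huu: "(?c H *\<^sub>v u) \<bullet> u' = (\<Sum>r<3 * n. cnj (f r) * (\<Sum>s<3 * n. complex_of_real (H $$ (r, s)) * f s))"
    using car H by (auto simp: scalar_prod_def u' f_def atLeast0LessThan mult.commute intro!: sum.cong)
  obtain t where t: "(\<Sum>r<3 * n. cnj (f r) * (\<Sum>s<3 * n. complex_of_real (H $$ (r, s)) * f s)) = of_real t"
    and lo: "a * (\<Sum>r<3 * n. (cmod (f r))\<^sup>2) \<le> t" and hi: "t \<le> b * (\<Sum>r<3 * n. (cmod (f r))\<^sup>2)"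
    unfolding H_def by (rule H_mat_quadratic_form[OF bounds])
  define A where "A = (\<Sum>r<3 * n. (cmod (f r))\<^sup>2)"
  \<comment> \<open>The transpose of \<open>Z\<close> is a left inverse, so \<open>u = 0\<close>
    would force \<open>w = 0\<close>.\<close>
  have "A \<noteq> 0"
  proof
    assume "A = 0"
    then have "f r = 0" if "r < 3 * n" for r
      using that by (simp add: A_def sum_nonneg_eq_0_iff)
    then have "u = 0\<^sub>v (3 * n)" using car(1) by (intro eq_vecI) (auto simp: f_def)
    then have "w = 0\<^sub>v l" using \<open>?Zt *\<^sub>v u = w\<close> Zt by auto
    then show False using w by simp
  qed
  then have A: "A > 0" using sum_nonneg[of "{..<3 * n}" "\<lambda>r. (cmod (f r))\<^sup>2"] by (simp add: A_def order.order_iff_strict)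
  have "of_real t = \<mu> * of_real A"
    using key unfolding uu Huu t A_def .
  then have "\<mu> = of_real (t / A)" using A by (simp add: field_simps)
  moreover have "a \<le> t / A" "t / A \<le> b"
    using lo hi A unfolding A_def[symmetric] by (simp_all add: field_simps)
  ultimately show ?thesis by blast
qed

lemma q_T_le:
  fixes \<alpha> \<theta> k C a b lam :: real and Z :: "real mat"
  defines "H \<equiv> H_mat d L N \<nu> F \<alpha> \<theta> k C"
  assumes bounds: "\<And>\<kappa>. \<kappa> \<in> F \<Longrightarrow> a \<le> \<alpha> + \<theta> * k * C * symb \<kappa> \<and> \<alpha> + \<theta> * k * C * symb \<kappa> \<le> b"
    and Z: "orthonormal_kernel_basis n B Z" and "lam > 0" "a > 0"
  shows "q_T H Z lam \<le> max \<bar>(lam - a) / (lam + a)\<bar> \<bar>(lam - b) / (lam + b)\<bar>"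
proof -
  let ?HT = "map_mat complex_of_real (transpose_mat Z * H * Z)"
  have Z: "Z \<in> carrier_mat (3 * n) (2 * n)" and orth: "transpose_mat Z * Z = 1\<^sub>m (2 * n)"
    using Z by (auto simp: orthonormal_kernel_basis_def)
  have HT: "?HT \<in> carrier_mat (2 * n) (2 * n)"
    using Z by (auto simp: H_def)
  show ?thesis
    unfolding q_T_def
  proof (rule Max.boundedI)
    show "finite ((\<lambda>\<mu>. cmod ((of_real lam - \<mu>) / (of_real lam + \<mu>))) ` spectrum ?HT)"
      using card_finite_spectrum(1)[OF HT] by simp
    \<comment> \<open>A complex matrix of positive size has an eigenvalue, so \<open>Max\<close> is
      taken over a nonempty set.\<close>
    show "(\<lambda>\<mu>. cmod ((of_real lam - \<mu>) / (of_real lam + \<mu>))) ` spectrum ?HT \<noteq> {}"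
      using spectrum_non_empty[OF HT] n_pos by simp
    fix v assume "v \<in> (\<lambda>\<mu>. cmod ((of_real lam - \<mu>) / (of_real lam + \<mu>))) ` spectrum ?HT"
    then obtain \<mu> where v: "v = cmod ((of_real lam - \<mu>) / (of_real lam + \<mu>))" and \<mu>: "\<mu> \<in> spectrum ?HT"
      by blast
    obtain t where t: "\<mu> = of_real t" "a \<le> t" "t \<le> b"
      using projected_spectrum[OF bounds Z orth] \<mu> unfolding H_def by blast
    have "v = \<bar>lam - t\<bar> / (lam + t)"
      using t assms by (simp add: v norm_divide flip: of_real_diff of_real_add)
    then show "v \<le> max \<bar>(lam - a) / (lam + a)\<bar> \<bar>(lam - b) / (lam + b)\<bar>"
      using cayley_bound[of lam a t b] t assms by (simp add: pos_divide_le_eq)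
  qed
qed

end

section \<open>Krylov spaces and GMRES\<close>

text \<open>\<open>pow_mat\<close> adds the new factor on the right, while the Krylov recursion
  needs it on the left.\<close>

lemma pow_mat_mult_vec_Suc:
  fixes P :: "'a::semiring_1 mat"
  assumes P: "P \<in> carrier_mat N N" and r: "r \<in> carrier_vec N"
  shows "P ^\<^sub>m Suc i *\<^sub>v r = P *\<^sub>v (P ^\<^sub>m i *\<^sub>v r)"
proof -
  have "P * P ^\<^sub>m i = P ^\<^sub>m i * P"
  proof (induction i)
    case (Suc i)
    have "P * (P ^\<^sub>m i * P) = P * P ^\<^sub>m i * P"
      using P by (intro assoc_mult_mat[symmetric, of _ N N _ N _ N]) auto
    then show ?case using Suc by simp
  qed (use P in auto)
  then have "P ^\<^sub>m Suc i *\<^sub>v r = (P * P ^\<^sub>m i) *\<^sub>v r" by simp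
  also have "\<dots> = P *\<^sub>v (P ^\<^sub>m i *\<^sub>v r)"
    using P r by (intro assoc_mult_mat_vec[of _ N N _ N]) auto
  finally show ?thesis .
qed

text \<open>Transfers the span facts of \<open>vec_space\<close> once and for all, so that later
  proofs need no interpretation.\<close>

lemma krylov_closed:
  assumes P: "P \<in> carrier_mat N N" and r: "r \<in> carrier_vec N"
  shows krylov_carrier: "v \<in> krylov P r j \<Longrightarrow> v \<in> carrier_vec N"
    and krylov_zero: "0\<^sub>v N \<in> krylov P r j"
    and krylov_add: "v \<in> krylov P r j \<Longrightarrow> w \<in> krylov P r j \<Longrightarrow> v + w \<in> krylov P r j"
    and krylov_smult: "v \<in> krylov P r j \<Longrightarrow> c \<cdot>\<^sub>v v \<in> krylov P r j"
    and krylov_power: "i < j \<Longrightarrow> P ^\<^sub>m i *\<^sub>v r \<in> krylov P r j"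
    and krylov_mono: "j \<le> j' \<Longrightarrow> krylov P r j \<subseteq> krylov P r j'"
    and krylov_0: "krylov P r 0 = {0\<^sub>v N}"
proof -
  interpret vec_space "TYPE(real)" N .
  let ?G = "\<lambda>j. (\<lambda>i. P ^\<^sub>m i *\<^sub>v r) ` {..<j}"
  have K: "krylov P r j = span (?G j)" for j
    using P by (simp add: krylov_def)
  have G: "?G j \<subseteq> carrier_vec N" for j
    using P r by (auto intro!: mult_mat_vec_carrier[of _ N N])
  show "v \<in> krylov P r j \<Longrightarrow> v \<in> carrier_vec N"
    unfolding K using span_closed[of "?G j" v] G by (simp add: module_vec_simps)
  show "0\<^sub>v N \<in> krylov P r j"
    unfolding K using span_zero[of "?G j"] by (simp add: module_vec_simps)
  show "v \<in> krylov P r j \<Longrightarrow> w \<in> krylov P r j \<Longrightarrow> v + w \<in> krylov P r j"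
    unfolding K using span_add1[of "?G j" v w] G by (simp add: module_vec_simps)
  show "v \<in> krylov P r j \<Longrightarrow> c \<cdot>\<^sub>v v \<in> krylov P r j"
    unfolding K by (rule smult_in_span[OF G])
  show "i < j \<Longrightarrow> P ^\<^sub>m i *\<^sub>v r \<in> krylov P r j"
    unfolding K by (rule span_mem) (use G in \<open>auto simp: module_vec_simps\<close>)
  show "j \<le> j' \<Longrightarrow> krylov P r j \<subseteq> krylov P r j'"
    unfolding K by (intro span_is_monotone image_mono) auto
  show "krylov P r 0 = {0\<^sub>v N}"
    unfolding K using span_empty by (simp add: module_vec_simps)
qed

text \<open>The residual map \<open>1 - c P\<close> of the Richardson iteration with step length
  \<open>c\<close>. Its powers supply the residual polynomial with which GMRES is compared.\<close>

definition richardson :: "real mat \<Rightarrow> real \<Rightarrow> real Matrix.vec \<Rightarrow> real Matrix.vec" where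
  "richardson P c v = v - c \<cdot>\<^sub>v (P *\<^sub>v v)"

lemma richardson_carrier:
  "P \<in> carrier_mat N N \<Longrightarrow> v \<in> carrier_vec N \<Longrightarrow> (richardson P c ^^ j) v \<in> carrier_vec N"
  by (induction j) (auto simp: richardson_def)

lemma richardson_linear:
  assumes P: "P \<in> carrier_mat N N" and v: "v \<in> carrier_vec N" and w: "w \<in> carrier_vec N"
  shows "(richardson P c ^^ j) (v - a \<cdot>\<^sub>v w) = (richardson P c ^^ j) v - a \<cdot>\<^sub>v (richardson P c ^^ j) w"
proof (induction j)
  case (Suc j)
  have step: "richardson P c (x - a \<cdot>\<^sub>v y) = richardson P c x - a \<cdot>\<^sub>v richardson P c y"
    if x: "x \<in> carrier_vec N" and y: "y \<in> carrier_vec N" for x y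
  proof -
    have "P *\<^sub>v x \<in> carrier_vec N" "P *\<^sub>v y \<in> carrier_vec N"
      using P by (auto intro!: mult_mat_vec_carrier[of _ N N] x y)
    moreover have "P *\<^sub>v (x - a \<cdot>\<^sub>v y) = P *\<^sub>v x - a \<cdot>\<^sub>v (P *\<^sub>v y)"
      using P x y by (simp add: mult_minus_distrib_mat_vec mult_mat_vec)
    ultimately show ?thesis
      using P x y by (intro eq_vecI) (auto simp: richardson_def algebra_simps simp del: index_mult_mat_vec)
  qed
  show ?case
    using step[OF richardson_carrier[OF P v] richardson_carrier[OF P w]] Suc by simp
qed simp

text \<open>\<open>(1 - c z)^j z^i\<close> has degree \<open>i + j\<close>, hence
  \<open>Suc (i + j)\<close> generators. The induction peels off the innermost step, which produces
  the exponents \<open>i\<close> and \<open>Suc i\<close>; therefore \<open>i\<close> is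
  arbitrary.\<close>

lemma richardson_in_krylov:
  assumes P: "P \<in> carrier_mat N N" and r: "r \<in> carrier_vec N"
  shows "(richardson P c ^^ j) (P ^\<^sub>m i *\<^sub>v r) \<in> krylov P r (Suc (i + j))"
proof (induction j arbitrary: i)
  case 0
  then show ?case using krylov_power[OF P r, of i "Suc i"] by simp
next
  case (Suc j)
  have pc: "P ^\<^sub>m i *\<^sub>v r \<in> carrier_vec N" for i using P r by (meson mult_mat_vec_carrier pow_carrier_mat)
  let ?a = "(richardson P c ^^ j) (P ^\<^sub>m i *\<^sub>v r)" and ?b = "(richardson P c ^^ j) (P ^\<^sub>m Suc i *\<^sub>v r)"
  have car: "?a \<in> carrier_vec N" "?b \<in> carrier_vec N"
    using P pc by (auto intro!: richardson_carrier simp del: pow_mat.simps)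
  have "(richardson P c ^^ Suc j) (P ^\<^sub>m i *\<^sub>v r) = (richardson P c ^^ j) (P ^\<^sub>m i *\<^sub>v r - c \<cdot>\<^sub>v (P ^\<^sub>m Suc i *\<^sub>v r))"
    unfolding funpow_Suc_right o_apply pow_mat_mult_vec_Suc[OF P r] by (simp add: richardson_def)
  also have "\<dots> = ?a - c \<cdot>\<^sub>v ?b"
    by (rule richardson_linear[OF P pc pc])
  also have "\<dots> = ?a + (- c) \<cdot>\<^sub>v ?b"
    using car by auto
  also have "\<dots> \<in> krylov P r (Suc (i + Suc j))"
    using Suc[of i] Suc[of "Suc i"] krylov_mono[OF P r, of "Suc (i + j)" "Suc (i + Suc j)"]
    by (intro krylov_add[OF P r] krylov_smult[OF P r]) auto
  finally show ?case .
qed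

text \<open>The polynomial \<open>(1 - c z)^j\<close> is 1 at 0, so it equals
  \<open>1 - z p(z)\<close> with \<open>p\<close> of degree below \<open>j\<close>, and
  \<open>v = p(P) r\<close>. In the induction \<open>v\<close> grows by \<open>c\<close> times the
  current residual.\<close>

lemma richardson_residual_polynomial:
  assumes P: "P \<in> carrier_mat N N" and r: "r \<in> carrier_vec N"
  shows "\<exists>v\<in>krylov P r j. (richardson P c ^^ j) r = r - P *\<^sub>v v"
proof (induction j)
  case 0
  then show ?case using krylov_zero[OF P r, of 0] P r by (intro bexI[of _ "0\<^sub>v N"]) auto
next
  case (Suc j)
  then obtain v where v: "v \<in> krylov P r j" and eq: "(richardson P c ^^ j) r = r - P *\<^sub>v v" by blast
  let ?w = "(richardson P c ^^ j) r"
  have w: "?w \<in> krylov P r (Suc j)"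
    using richardson_in_krylov[OF P r, where c = c and j = j and i = 0] P r by simp
  have car: "v \<in> carrier_vec N" "?w \<in> carrier_vec N" "P *\<^sub>v v \<in> carrier_vec N" "P *\<^sub>v ?w \<in> carrier_vec N"
    using krylov_carrier[OF P r] v w P by auto
  have "v + c \<cdot>\<^sub>v ?w \<in> krylov P r (Suc j)"
    using v w krylov_mono[OF P r, of j "Suc j"] by (intro krylov_add[OF P r] krylov_smult[OF P r]) auto
  moreover have "(richardson P c ^^ Suc j) r = r - P *\<^sub>v (v + c \<cdot>\<^sub>v ?w)"
  proof -
    have "P *\<^sub>v (v + c \<cdot>\<^sub>v ?w) = P *\<^sub>v v + c \<cdot>\<^sub>v (P *\<^sub>v ?w)"
      using P car by (simp add: mult_add_distrib_mat_vec mult_mat_vec)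
    moreover have "(richardson P c ^^ Suc j) r = (r - P *\<^sub>v v) - c \<cdot>\<^sub>v (P *\<^sub>v ?w)"
      by (simp add: richardson_def flip: eq)
    ultimately show ?thesis
      using car r by (intro eq_vecI) (auto simp del: index_mult_mat_vec)
  qed
  ultimately show ?case by blast
qed

text \<open>\<open>x0 + v\<close> is a competitor whose residual is the Richardson residual. Krylov
  spaces are nested, so a competitor for \<open>j\<close> serves every later iterate as
  well.\<close>

lemma gmres_residual_le:
  assumes Mi: "mat_inv M \<in> carrier_mat N N" and A: "A \<in> carrier_mat N N"
    and b: "b \<in> carrier_vec N" and x0: "x0 \<in> carrier_vec N"
    and x: "gmres_iterate M A b x0 n x" and j: "j \<le> n"
  shows "vec_norm (precond_residual M A b x)
    \<le> vec_norm ((richardson (mat_inv M * A) c ^^ j) (precond_residual M A b x0))"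
proof -
  let ?P = "mat_inv M * A" and ?r = "precond_residual M A b x0"
  have P: "?P \<in> carrier_mat N N" using Mi A by simp
  have r: "?r \<in> carrier_vec N" using Mi A b x0 by (simp add: precond_residual_def)
  obtain v where v: "v \<in> krylov ?P ?r j" and eq: "(richardson ?P c ^^ j) ?r = ?r - ?P *\<^sub>v v"
    using richardson_residual_polynomial[OF P r] by blast
  have vc: "v \<in> carrier_vec N" by (rule krylov_carrier[OF P r v])
  have car: "A *\<^sub>v x0 \<in> carrier_vec N" "A *\<^sub>v v \<in> carrier_vec N"
    using A x0 vc by (auto intro!: mult_mat_vec_carrier[of _ N N])
  have "b - A *\<^sub>v (x0 + v) = (b - A *\<^sub>v x0) - A *\<^sub>v v"
    unfolding mult_add_distrib_mat_vec[OF A x0 vc]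
    using b car by (intro eq_vecI) (auto simp del: index_mult_mat_vec)
  then have "precond_residual M A b (x0 + v) = ?r - ?P *\<^sub>v v"
    unfolding precond_residual_def using Mi A b vc car
    by (simp add: mult_minus_distrib_mat_vec[of _ N N] assoc_mult_mat_vec[of _ N N _ N])
  moreover have "v \<in> krylov ?P ?r n" using v krylov_mono[OF P r j] by blast
  ultimately show ?thesis
    using x unfolding gmres_iterate_def Let_def eq by fastforce
qed

lemma gmres_iterate_0:
  assumes Mi: "mat_inv M \<in> carrier_mat N N" and A: "A \<in> carrier_mat N N"
    and b: "b \<in> carrier_vec N" and x0: "x0 \<in> carrier_vec N"
    and x: "gmres_iterate M A b x0 0 x"
  shows "x = x0"
proof -
  have P: "mat_inv M * A \<in> carrier_mat N N" using Mi A by simp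
  have r: "precond_residual M A b x0 \<in> carrier_vec N" using Mi A b x0 by (simp add: precond_residual_def)
  show ?thesis
    using x x0 krylov_0[OF P r] unfolding gmres_iterate_def Let_def by auto
qed

text \<open>Injectivity gives a nonzero determinant, so \<open>mat_inverse\<close> succeeds and
  \<open>mat_inv\<close> is a genuine inverse.\<close>

lemma mat_inv_carrier:
  assumes M: "M \<in> carrier_mat N N"
    and inj: "\<And>v. v \<in> carrier_vec N \<Longrightarrow> M *\<^sub>v v = 0\<^sub>v N \<Longrightarrow> v = 0\<^sub>v N"
  shows "mat_inv M \<in> carrier_mat N N" and "M * mat_inv M = 1\<^sub>m N"
proof -
  have "Determinant.det M \<noteq> 0"
    using det_0_iff_vec_prod_zero_field[OF M] inj by blast
  then have "mat_inverse M \<noteq> None"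
    using mat_inverse(1)[OF M, of "()"] det_non_zero_imp_unit[OF M, of "()"] by auto
  then obtain B where "mat_inverse M = Some B" by blast
  then show "mat_inv M \<in> carrier_mat N N" "M * mat_inv M = 1\<^sub>m N"
    using mat_inverse(2)[OF M] by (auto simp: mat_inv_def)
qed

section \<open>Contraction in two steps\<close>

text \<open>\<open>V\<close> sends \<open>skew_plus n m lam x\<close> to
  \<open>skew_minus n m lam x\<close>; carrying the common preimage \<open>x\<close> along avoids an
  inverse of \<open>lam + S\<close>.\<close>

definition skew_plus :: "nat \<Rightarrow> (nat \<Rightarrow> real^3) \<Rightarrow> real \<Rightarrow> real Matrix.vec \<Rightarrow> real Matrix.vec" where
  "skew_plus n m lam x = lam \<cdot>\<^sub>v x + skew_mat n m *\<^sub>v x"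

definition skew_minus :: "nat \<Rightarrow> (nat \<Rightarrow> real^3) \<Rightarrow> real \<Rightarrow> real Matrix.vec \<Rightarrow> real Matrix.vec" where
  "skew_minus n m lam x = lam \<cdot>\<^sub>v x - skew_mat n m *\<^sub>v x"

lemma skew_mult_carrier: "x \<in> carrier_vec (4 * n) \<Longrightarrow> skew_mat n m *\<^sub>v x \<in> carrier_vec (4 * n)"
  by (rule mult_mat_vec_carrier[OF skew_mat_carrier])

lemma skew_plus_carrier: "x \<in> carrier_vec (4 * n) \<Longrightarrow> skew_plus n m lam x \<in> carrier_vec (4 * n)"
  and skew_minus_carrier: "x \<in> carrier_vec (4 * n) \<Longrightarrow> skew_minus n m lam x \<in> carrier_vec (4 * n)"
  by (simp_all add: skew_plus_def skew_minus_def skew_mult_carrier)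

lemma skew_plus_parts:
  assumes "x \<in> carrier_vec (4 * n)" "p < n"
  shows "vector_part (skew_plus n m lam x) p
      = lam *\<^sub>R vector_part x p + (cross3 (m p) (vector_part x p) + scalar_part n x p *\<^sub>R m p)"
    and "scalar_part n (skew_plus n m lam x) p = lam * scalar_part n x p + - (m p \<bullet> vector_part x p)"
    and "vector_part (skew_minus n m lam x) p
      = lam *\<^sub>R vector_part x p - (cross3 (m p) (vector_part x p) + scalar_part n x p *\<^sub>R m p)"
    and "scalar_part n (skew_minus n m lam x) p = lam * scalar_part n x p - - (m p \<bullet> vector_part x p)"
  unfolding skew_plus_def skew_minus_def using assms
  by (simp_all add: skew_mult_carrier vector_part_add vector_part_minus vector_part_smult
      vector_part_skew scalar_part_skew del: minus_mult_distrib_mat_vec)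

lemma vec_norm_skew_plus:
  assumes x: "x \<in> carrier_vec (4 * n)"
  shows "(vec_norm (skew_plus n m lam x))\<^sup>2
    = (\<Sum>p<n. (lam\<^sup>2 + (norm (m p))\<^sup>2) * ((norm (vector_part x p))\<^sup>2 + (scalar_part n x p)\<^sup>2))"
  unfolding vec_norm_sq[OF skew_plus_carrier[OF x]] vector_mass_def scalar_mass_def sum.distrib[symmetric]
  by (intro sum.cong) (auto simp only: skew_plus_parts[OF x] lessThan_iff node_norm_plus)

text \<open>This is the isometry of \<open>V\<close>: at each node \<open>lam + m\<close> and
  \<open>lam - m\<close> have the same quaternion norm.\<close>

lemma vec_norm_skew_minus:
  assumes x: "x \<in> carrier_vec (4 * n)"
  shows "(vec_norm (skew_minus n m lam x))\<^sup>2 = (vec_norm (skew_plus n m lam x))\<^sup>2"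
  unfolding vec_norm_skew_plus[OF x]
  unfolding vec_norm_sq[OF skew_minus_carrier[OF x]] vector_mass_def scalar_mass_def sum.distrib[symmetric]
  by (intro sum.cong) (auto simp only: skew_plus_parts[OF x] lessThan_iff node_norm_minus)

text \<open>With the upper bound that follows, this controls the conditioning of
  \<open>lam + S\<close>; the quotient of the two constants becomes \<open>\<kappa>0^2\<close>. The
  case \<open>c = 0\<close> gives injectivity.\<close>

lemma vec_norm_skew_plus_lower:
  assumes x: "x \<in> carrier_vec (4 * n)" and c: "0 \<le> c" "\<And>p. p < n \<Longrightarrow> c \<le> norm (m p)"
  shows "(lam\<^sup>2 + c\<^sup>2) * (vec_norm x)\<^sup>2 \<le> (vec_norm (skew_plus n m lam x))\<^sup>2"
  unfolding vec_norm_skew_plus[OF x] vec_norm_sq[OF x] vector_mass_def scalar_mass_def sum.distrib[symmetric]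
    sum_distrib_left
  using c by (intro sum_mono mult_right_mono add_left_mono power_mono) auto

lemma vec_norm_skew_plus_upper:
  assumes x: "x \<in> carrier_vec (4 * n)" and c: "\<And>p. p < n \<Longrightarrow> norm (m p) \<le> c"
  shows "(vec_norm (skew_plus n m lam x))\<^sup>2 \<le> (lam\<^sup>2 + c\<^sup>2) * (vec_norm x)\<^sup>2"
  unfolding vec_norm_skew_plus[OF x] vec_norm_sq[OF x] vector_mass_def scalar_mass_def sum.distrib[symmetric]
    sum_distrib_left
  using c by (intro sum_mono mult_right_mono add_left_mono power_mono) auto

lemma vec_norm_nonneg: "vec_norm x \<ge> 0"
  by (simp add: vec_norm_def)

lemma vec_norm_eq_0_iff:
  assumes "x \<in> carrier_vec N"
  shows "vec_norm x = 0 \<longleftrightarrow> x = 0\<^sub>v N"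
  using assms by (auto simp: vec_norm_def L2_set_eq_0_iff intro!: eq_vecI)

text \<open>The nodal bound \<open>node_coupling\<close> is taken in the 2-norm over the nodes,
  where Minkowski's inequality separates the two terms.\<close>

lemma skew_coupling:
  assumes x: "x \<in> carrier_vec (4 * n)" and lam: "lam > 0" and g0: "0 \<le> g"
    and g: "\<And>p. p < n \<Longrightarrow> g \<le> 2 * lam * norm (m p) / (lam\<^sup>2 + (norm (m p))\<^sup>2)"
  shows "g * sqrt (scalar_mass n (skew_plus n m lam x))
    \<le> sqrt (vector_mass n (skew_minus n m lam x)) + sqrt (vector_mass n (skew_plus n m lam x))"
proof -
  let ?u = "skew_plus n m lam x" and ?z = "skew_minus n m lam x"
  have "g * sqrt (scalar_mass n ?u) = L2_set (\<lambda>p. g * \<bar>scalar_part n ?u p\<bar>) {..<n}"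
    using g0 by (simp add: L2_set_def scalar_mass_def power_mult_distrib real_sqrt_mult flip: sum_distrib_left)
  also have "\<dots> \<le> L2_set (\<lambda>p. norm (vector_part ?z p) + norm (vector_part ?u p)) {..<n}"
  proof (rule L2_set_mono)
    fix p assume "p \<in> {..<n}"
    then have p: "p < n" by simp
    have "g * \<bar>scalar_part n ?u p\<bar> \<le> 2 * lam * norm (m p) / (lam\<^sup>2 + (norm (m p))\<^sup>2) * \<bar>scalar_part n ?u p\<bar>"
      using g[OF p] by (rule mult_right_mono) simp
    also have "\<dots> \<le> norm (vector_part ?z p) + norm (vector_part ?u p)"
      unfolding skew_plus_parts[OF x p] by (rule node_coupling[OF lam])
    finally show "g * \<bar>scalar_part n ?u p\<bar> \<le> norm (vector_part ?z p) + norm (vector_part ?u p)" .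
  qed (use g0 in simp)
  also have "\<dots> \<le> sqrt (vector_mass n ?z) + sqrt (vector_mass n ?u)"
    using L2_set_triangle_ineq[of "\<lambda>p. norm (vector_part ?z p)" "\<lambda>p. norm (vector_part ?u p)" "{..<n}"]
    by (simp add: L2_set_def vector_mass_def)
  finally show ?thesis .
qed

text \<open>The numbers are the masses along \<open>w\<close>, \<open>u = Qw\<close>,
  \<open>z = Vu\<close>, \<open>u' = Qz\<close>. The two applications of \<open>Q\<close> lose at
  least \<open>(1 - q^2) * (Vw + Vz)\<close>. If \<open>Vw\<close> is small, the mass sits in
  \<open>Ww = Wu\<close>, and the coupling then makes \<open>Vz\<close> large; so the loss is a
  fixed fraction of the total.\<close>

lemma two_step_bound:
  fixes q g :: real
  assumes nonneg: "0 \<le> Vw" "0 \<le> Ww" "0 \<le> Vu" "0 \<le> Vz" and q: "0 \<le> q" "q < 1" and g: "0 < g"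
    and first: "Vu \<le> q\<^sup>2 * Vw" "Wu = Ww" and isometry: "Vz + Wz = Vu + Wu"
    and second: "Vu' \<le> q\<^sup>2 * Vz" "Wu' = Wz"
    and coupling: "g * sqrt Wu \<le> sqrt Vz + sqrt Vu"
  shows "Vu' + Wu' \<le> (1 - (1 - q\<^sup>2) * g\<^sup>2 / (g\<^sup>2 + 1 + q\<^sup>2)) * (Vw + Ww)"
proof -
  have q2: "0 \<le> 1 - q\<^sup>2" using q by (simp add: power_le_one)
  define D where "D = g\<^sup>2 + 1 + q\<^sup>2"
  have D: "D > 0" using g by (simp add: D_def add_pos_nonneg)
  have "sqrt Vu \<le> q * sqrt Vw"
    using real_sqrt_le_mono[OF first(1)] q(1) by (simp add: real_sqrt_mult)
  then have "g * sqrt Ww \<le> sqrt Vz + q * sqrt Vw"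
    using coupling first(2) by simp
  then have "(g * sqrt Ww)\<^sup>2 \<le> (sqrt Vz + q * sqrt Vw)\<^sup>2"
    using nonneg g by (intro power_mono) auto
  \<comment> \<open>Cauchy-Schwarz for \<open>(1, q)\<close> and
    \<open>(sqrt Vz, sqrt Vw)\<close>.\<close>
  also have "\<dots> \<le> (1 + q\<^sup>2) * ((sqrt Vz)\<^sup>2 + (sqrt Vw)\<^sup>2)"
    using zero_le_power2[of "q * sqrt Vz - sqrt Vw"] by (simp add: power2_eq_square algebra_simps)
  finally have "g\<^sup>2 * Ww \<le> (1 + q\<^sup>2) * (Vz + Vw)"
    using nonneg by (simp add: power_mult_distrib)
  moreover have "0 \<le> g\<^sup>2 * Vz" using nonneg by simp
  \<comment> \<open>Adding \<open>g^2 * Vw\<close> on both sides and \<open>g^2 * Vz\<close> on the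
    right completes the factor \<open>D\<close>.\<close>
  ultimately have "g\<^sup>2 * (Vw + Ww) \<le> D * (Vw + Vz)"
    by (simp add: D_def algebra_simps)
  then have "g\<^sup>2 / D * (Vw + Ww) \<le> Vw + Vz"
    using D by (simp add: field_simps)
  then have "(1 - q\<^sup>2) * (g\<^sup>2 / D * (Vw + Ww)) \<le> (1 - q\<^sup>2) * (Vw + Vz)"
    using q2 by (rule mult_left_mono)
  moreover have "Vu' + Wu' \<le> (Vw + Ww) - (1 - q\<^sup>2) * (Vw + Vz)"
    using first second isometry by (simp add: algebra_simps)
  ultimately show ?thesis
    unfolding D_def[symmetric] by (simp add: algebra_simps)
qed

section \<open>The preconditioned step as a product of Cayley transforms\<close>

lemma saddle_mat_split:
  assumes "H \<in> carrier_mat (3 * n) (3 * n)"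
  shows "saddle_mat n H m = sym_mat n H + skew_mat n m"
  unfolding saddle_mat_def sym_mat_def skew_mat_def using assms S_mat_carrier[of n m] B_mat_carrier[of n m]
  by (subst add_four_block_mat[of _ "3 * n" "3 * n" _ n _ n]) auto

lemma precond_mat_mult_vec:
  assumes H: "H \<in> carrier_mat (3 * n) (3 * n)" and x: "x \<in> carrier_vec (4 * n)"
  shows "precond_mat n H m lam *\<^sub>v x
    = lam \<cdot>\<^sub>v skew_plus n m lam x + sym_mat n H *\<^sub>v skew_plus n m lam x"
proof -
  have shift: "(lam \<cdot>\<^sub>m 1\<^sub>m (4 * n) + K) *\<^sub>v y = lam \<cdot>\<^sub>v y + K *\<^sub>v y"
    if "K \<in> carrier_mat (4 * n) (4 * n)" "y \<in> carrier_vec (4 * n)" for K y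
    using that by (subst add_mult_distrib_mat_vec[of _ "4 * n" "4 * n"]) auto
  show ?thesis
    unfolding precond_mat_def sym_mat_def[symmetric] skew_mat_def[symmetric]
    using H x by (subst assoc_mult_mat_vec[of _ "4 * n" "4 * n" _ "4 * n"])
      (auto simp: shift skew_plus_carrier skew_plus_def[symmetric])
qed

text \<open>With \<open>a = Sx\<close>, \<open>b = Kx\<close>, \<open>c = KSx\<close> this is
  \<open>(lam + K)(lam + S) - 2 lam (K + S) = (lam - K)(lam - S)\<close> applied to
  \<open>x\<close>.\<close>

lemma splitting_identity:
  fixes lam :: real
  assumes "x \<in> carrier_vec N" "a \<in> carrier_vec N" "b \<in> carrier_vec N" "c \<in> carrier_vec N"
  shows "lam \<cdot>\<^sub>v (lam \<cdot>\<^sub>v x + a) + (lam \<cdot>\<^sub>v b + c) - (2 * lam) \<cdot>\<^sub>v (b + a)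
    = lam \<cdot>\<^sub>v (lam \<cdot>\<^sub>v x - a) - (lam \<cdot>\<^sub>v b - c)"
  using assms by (intro eq_vecI) (auto simp: algebra_simps)

context periodic_grid
begin

context
  fixes \<alpha> \<theta> k C lam q :: real and m :: "nat \<Rightarrow> real^3"
  assumes lam: "lam > 0"
    and pos: "\<And>\<kappa>. \<kappa> \<in> F \<Longrightarrow> 0 < lam + (\<alpha> + \<theta> * k * C * symb \<kappa>)"
    and q: "\<And>\<kappa>. \<kappa> \<in> F \<Longrightarrow>
      \<bar>lam - (\<alpha> + \<theta> * k * C * symb \<kappa>)\<bar> \<le> q * (lam + (\<alpha> + \<theta> * k * C * symb \<kappa>))"
begin

abbreviation "H \<equiv> H_mat d L N \<nu> F \<alpha> \<theta> k C"
abbreviation "A \<equiv> saddle_mat n H m"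
abbreviation "M \<equiv> precond_mat n H m lam"
abbreviation "sp \<equiv> skew_plus n m lam"
abbreviation "sm \<equiv> skew_minus n m lam"
text \<open>The step length \<open>2 * lam\<close> is the one for which
  \<open>splitting_identity\<close> factors \<open>M - 2 lam A\<close>.\<close>

abbreviation "step \<equiv> richardson (mat_inv M * A) (2 * lam)"

lemma sym_mult_carrier: "x \<in> carrier_vec (4 * n) \<Longrightarrow> sym_mat n H *\<^sub>v x \<in> carrier_vec (4 * n)"
  by (rule mult_mat_vec_carrier[OF sym_mat_carrier[OF H_mat_carrier]])

lemma A_carrier: "A \<in> carrier_mat (4 * n) (4 * n)"
  unfolding saddle_mat_split[OF H_mat_carrier] by (auto intro: sym_mat_carrier)

lemma M_carrier: "M \<in> carrier_mat (4 * n) (4 * n)"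
  unfolding precond_mat_def sym_mat_def[symmetric] skew_mat_def[symmetric]
  by (intro mult_carrier_mat[of _ _ "4 * n"] add_carrier_mat sym_mat_carrier H_mat_carrier skew_mat_carrier)

text \<open>If \<open>M\<close> annihilates \<open>x\<close>, then \<open>sp x = Q 0\<close>, so
  \<open>cayley_contraction\<close> with \<open>y = 0\<close> makes \<open>sp x\<close> vanish, and
  the lower bound for \<open>sp\<close> does the same to \<open>x\<close>.\<close>

lemma M_injective:
  assumes x: "x \<in> carrier_vec (4 * n)" and "M *\<^sub>v x = 0\<^sub>v (4 * n)"
  shows "x = 0\<^sub>v (4 * n)"
proof -
  have spx: "sp x \<in> carrier_vec (4 * n)" by (rule skew_plus_carrier[OF x])
  have z: "sym_mat n H *\<^sub>v 0\<^sub>v (4 * n) = 0\<^sub>v (4 * n)"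
    using carrier_matD[OF sym_mat_carrier[OF H_mat_carrier]]
    by (intro eq_vecI) (auto simp: scalar_prod_def)
  have "lam \<cdot>\<^sub>v sp x + sym_mat n H *\<^sub>v sp x = lam \<cdot>\<^sub>v 0\<^sub>v (4 * n) - sym_mat n H *\<^sub>v 0\<^sub>v (4 * n)"
    unfolding z using assms(2) precond_mat_mult_vec[OF H_mat_carrier x] by auto
  note contr = cayley_contraction[OF pos q less_imp_neq[OF lam, symmetric] spx zero_carrier_vec this]
  have "vector_mass n (0\<^sub>v (4 * n)) = 0" "scalar_mass n (0\<^sub>v (4 * n)) = 0"
    by (simp_all add: vector_mass_def scalar_mass_def vector_part_zero)
  then have "(vec_norm (sp x))\<^sup>2 = 0"
    using contr vector_mass_nonneg[of n "sp x"] by (simp add: vec_norm_sq[OF spx])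
  then have "lam\<^sup>2 * (vec_norm x)\<^sup>2 \<le> 0"
    using vec_norm_skew_plus_lower[OF x, of 0 m lam] by simp
  then have "vec_norm x = 0"
    using lam by (simp add: mult_le_0_iff power2_less_eq_zero_iff)
  then show ?thesis using vec_norm_eq_0_iff[OF x] by simp
qed

lemma mat_inv_M: "mat_inv M \<in> carrier_mat (4 * n) (4 * n)" "M * mat_inv M = 1\<^sub>m (4 * n)"
  using mat_inv_carrier[OF M_carrier M_injective] by auto

lemma P_carrier: "mat_inv M * A \<in> carrier_mat (4 * n) (4 * n)"
  using mat_inv_M(1) A_carrier by simp

lemma step_carrier: "x \<in> carrier_vec (4 * n) \<Longrightarrow> (step ^^ j) x \<in> carrier_vec (4 * n)"
  by (rule richardson_carrier[OF P_carrier])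

text \<open>This says \<open>sp (step x) = Q (V (sp x))\<close>: in the variable \<open>sp x\<close>
  one step is the product \<open>QV\<close>.\<close>

lemma step_eq:
  assumes x: "x \<in> carrier_vec (4 * n)"
  shows "lam \<cdot>\<^sub>v sp (step x) + sym_mat n H *\<^sub>v sp (step x) = lam \<cdot>\<^sub>v sm x - sym_mat n H *\<^sub>v sm x"
proof -
  let ?S = "skew_mat n m" and ?K = "sym_mat n H"
  have K: "?K \<in> carrier_mat (4 * n) (4 * n)" by (rule sym_mat_carrier[OF H_mat_carrier])
  note car = x skew_mult_carrier[OF x] sym_mult_carrier[OF x] sym_mult_carrier[OF skew_mult_carrier[OF x]]
  have Px: "(mat_inv M * A) *\<^sub>v x \<in> carrier_vec (4 * n)"
    using P_carrier x by (rule mult_mat_vec_carrier)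
  have Ax: "A *\<^sub>v x \<in> carrier_vec (4 * n)"
    using A_carrier x by (rule mult_mat_vec_carrier)
  have stx: "step x \<in> carrier_vec (4 * n)" using step_carrier[OF x, of 1] by simp
  have "M *\<^sub>v ((mat_inv M * A) *\<^sub>v x) = (M * mat_inv M) *\<^sub>v (A *\<^sub>v x)"
    using M_carrier mat_inv_M(1) A_carrier x Ax
    by (simp add: assoc_mult_mat_vec[of _ "4 * n" "4 * n" _ "4 * n"])
  then have MP: "M *\<^sub>v ((mat_inv M * A) *\<^sub>v x) = A *\<^sub>v x"
    using Ax by (simp add: mat_inv_M)
  have Ax': "A *\<^sub>v x = ?K *\<^sub>v x + ?S *\<^sub>v x"
    unfolding saddle_mat_split[OF H_mat_carrier] by (rule add_mult_distrib_mat_vec[OF K skew_mat_carrier x])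
  have KS: "?K *\<^sub>v sp x = lam \<cdot>\<^sub>v (?K *\<^sub>v x) + ?K *\<^sub>v (?S *\<^sub>v x)"
    "?K *\<^sub>v sm x = lam \<cdot>\<^sub>v (?K *\<^sub>v x) - ?K *\<^sub>v (?S *\<^sub>v x)"
    unfolding skew_plus_def skew_minus_def using K car
    by (simp_all add: mult_add_distrib_mat_vec[OF K] mult_minus_distrib_mat_vec[OF K] mult_mat_vec[OF K])
  have "lam \<cdot>\<^sub>v sp (step x) + ?K *\<^sub>v sp (step x) = M *\<^sub>v step x"
    by (rule precond_mat_mult_vec[OF H_mat_carrier stx, symmetric])
  also have "\<dots> = M *\<^sub>v x - (2 * lam) \<cdot>\<^sub>v (A *\<^sub>v x)"
    unfolding richardson_def using Px x
    by (simp add: mult_minus_distrib_mat_vec[OF M_carrier] mult_mat_vec[OF M_carrier] MP)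
  also have "\<dots> = lam \<cdot>\<^sub>v sm x - ?K *\<^sub>v sm x"
    unfolding precond_mat_mult_vec[OF H_mat_carrier x] Ax' KS unfolding skew_plus_def skew_minus_def
    using car by (intro splitting_identity)
  finally show ?thesis .
qed

lemma two_step_contraction:
  assumes x: "x \<in> carrier_vec (4 * n)" and q01: "0 \<le> q" "q < 1" and g0: "0 < g"
    and g: "\<And>p. p < n \<Longrightarrow> g \<le> 2 * lam * norm (m p) / (lam\<^sup>2 + (norm (m p))\<^sup>2)"
  shows "(vec_norm (sp (step (step x))))\<^sup>2
    \<le> (1 - (1 - q\<^sup>2) * g\<^sup>2 / (g\<^sup>2 + 1 + q\<^sup>2)) * (vec_norm (sp x))\<^sup>2"
proof -
  have x': "step x \<in> carrier_vec (4 * n)" and x'': "step (step x) \<in> carrier_vec (4 * n)"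
    using step_carrier[OF x, of 1] step_carrier[OF x, of 2] by (simp_all add: numeral_2_eq_2)
  note car = skew_plus_carrier[OF x] skew_plus_carrier[OF x'] skew_plus_carrier[OF x'']
    skew_minus_carrier[OF x] skew_minus_carrier[OF x']
  note contr = cayley_contraction[OF pos q less_imp_neq[OF lam, symmetric] car(2) car(4) step_eq[OF x]]
  note contr' = cayley_contraction[OF pos q less_imp_neq[OF lam, symmetric] car(3) car(5) step_eq[OF x']]
  show ?thesis
    \<comment> \<open>As \<open>V\<close> is an isometry, the chain can start at
      \<open>sm x = V (sp x)\<close>, where \<open>Q\<close> acts next.\<close>
    unfolding vec_norm_skew_minus[OF x, symmetric]
    unfolding vec_norm_sq[OF car(3)] vec_norm_sq[OF car(4)]
  proof (rule two_step_bound[OF _ _ _ _ q01 g0 contr _ contr'])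
    show "vector_mass n (sm (step x)) + scalar_mass n (sm (step x))
        = vector_mass n (sp (step x)) + scalar_mass n (sp (step x))"
      using vec_norm_skew_minus[OF x', of m lam] unfolding vec_norm_sq[OF car(2)] vec_norm_sq[OF car(5)] .
    show "g * sqrt (scalar_mass n (sp (step x))) \<le> sqrt (vector_mass n (sm (step x))) + sqrt (vector_mass n (sp (step x)))"
      using g0 by (intro skew_coupling[OF x' lam _ g]) auto
  qed (simp_all add: vector_mass_nonneg scalar_mass_nonneg)
qed

text \<open>Double steps contract in the norm of \<open>sp x\<close>. Passing to that norm and back
  costs the conditioning factor of \<open>lam + S\<close> once, independently of
  \<open>j\<close>.\<close>

lemma richardson_bound:
  fixes g c_lo c_hi :: real
  assumes x: "x \<in> carrier_vec (4 * n)" and q01: "0 \<le> q" "q < 1" and g0: "0 < g"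
    and g: "\<And>p. p < n \<Longrightarrow> g \<le> 2 * lam * norm (m p) / (lam\<^sup>2 + (norm (m p))\<^sup>2)"
    and c: "0 < c_lo" "\<And>p. p < n \<Longrightarrow> c_lo \<le> norm (m p) \<and> norm (m p) \<le> c_hi"
  shows "vec_norm ((step ^^ (2 * j)) x)
    \<le> sqrt ((lam\<^sup>2 + c_hi\<^sup>2) / (lam\<^sup>2 + c_lo\<^sup>2)) * sqrt (1 - (1 - q\<^sup>2) * g\<^sup>2 / (g\<^sup>2 + 1 + q\<^sup>2)) ^ j * vec_norm x"
proof -
  define t where "t = 1 - (1 - q\<^sup>2) * g\<^sup>2 / (g\<^sup>2 + 1 + q\<^sup>2)"
  have D: "g\<^sup>2 + 1 + q\<^sup>2 > 0" by (simp add: add_nonneg_pos add_pos_nonneg)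
  have "(1 - q\<^sup>2) * g\<^sup>2 \<le> 1 * g\<^sup>2"
    by (intro mult_right_mono) auto
  also have "\<dots> \<le> g\<^sup>2 + 1 + q\<^sup>2" by simp
  finally have t: "0 \<le> t"
    using D by (simp add: t_def divide_le_eq)
  have iter: "(vec_norm (sp ((step ^^ (2 * j)) x)))\<^sup>2 \<le> t ^ j * (vec_norm (sp x))\<^sup>2" for j
  proof (induction j)
    case (Suc j)
    let ?y = "(step ^^ (2 * j)) x"
    have "(step ^^ (2 * Suc j)) x = step (step ?y)" by simp
    then have "(vec_norm (sp ((step ^^ (2 * Suc j)) x)))\<^sup>2 \<le> t * (vec_norm (sp ?y))\<^sup>2"
      unfolding t_def using two_step_contraction[OF step_carrier[OF x] q01 g0 g] by metis
    also have "\<dots> \<le> t * (t ^ j * (vec_norm (sp x))\<^sup>2)"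
      by (rule mult_left_mono[OF Suc t])
    finally show ?case by (simp add: mult.assoc)
  qed simp
  define lo hi where "lo = lam\<^sup>2 + c_lo\<^sup>2" and "hi = lam\<^sup>2 + c_hi\<^sup>2"
  have lo: "lo > 0" using lam by (simp add: lo_def add_pos_nonneg)
  have hi: "hi \<ge> 0" by (simp add: hi_def)
  have "lo * (vec_norm ((step ^^ (2 * j)) x))\<^sup>2 \<le> (vec_norm (sp ((step ^^ (2 * j)) x)))\<^sup>2"
    unfolding lo_def using c by (intro vec_norm_skew_plus_lower[OF step_carrier[OF x]]) auto
  also have "\<dots> \<le> t ^ j * (vec_norm (sp x))\<^sup>2" by (rule iter)
  also have "\<dots> \<le> t ^ j * (hi * (vec_norm x)\<^sup>2)"
    unfolding hi_def using t c by (intro mult_left_mono vec_norm_skew_plus_upper[OF x]) auto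
  finally have "(vec_norm ((step ^^ (2 * j)) x))\<^sup>2 \<le> hi / lo * t ^ j * (vec_norm x)\<^sup>2"
    using lo by (simp add: field_simps)
  also have "\<dots> = (sqrt (hi / lo) * sqrt t ^ j * vec_norm x)\<^sup>2"
    using lo hi t by (simp add: power_mult_distrib real_sqrt_power[symmetric])
  finally show ?thesis
    unfolding t_def[symmetric] lo_def[symmetric] hi_def[symmetric]
    by (rule power2_le_imp_le) (use lo hi t in \<open>simp add: vec_norm_nonneg\<close>)
qed

end

end

text \<open>The coupling strength increases in \<open>t\<close> up to \<open>lam\<close> and
  decreases afterwards, so its minimum over an interval is at an endpoint.\<close>

lemma coupling_ge_min:
  fixes lam a b t :: real
  assumes "lam > 0" "0 < a" "a \<le> t" "t \<le> b"
  shows "min (2 * lam * a / (lam\<^sup>2 + a\<^sup>2)) (2 * lam * b / (lam\<^sup>2 + b\<^sup>2)) \<le> 2 * lam * t / (lam\<^sup>2 + t\<^sup>2)"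
proof -
  \<comment> \<open>After clearing denominators, right minus left is a positive multiple of
    \<open>(t - s) * (lam^2 - s * t)\<close>.\<close>
  have key: "2 * lam * s / (lam\<^sup>2 + s\<^sup>2) \<le> 2 * lam * t / (lam\<^sup>2 + t\<^sup>2)"
    if "0 < s" "0 \<le> (t - s) * (lam\<^sup>2 - s * t)" for s
  proof -
    have "0 \<le> 2 * lam * ((t - s) * (lam\<^sup>2 - s * t))" using that assms by simp
    then show ?thesis
      using that assms by (simp add: divide_simps add_pos_pos power2_eq_square algebra_simps)
  qed
  show ?thesis
  proof (cases "a * t \<le> lam\<^sup>2")
    case True
    then show ?thesis using key[of a] assms by (auto intro: min.coboundedI1)
  next
    case False
    have "a * t \<le> b * t" using assms by (intro mult_right_mono) auto
    then have "lam\<^sup>2 - b * t \<le> 0" using False by linarith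
    then have "0 \<le> (t - b) * (lam\<^sup>2 - b * t)" using assms by (intro mult_nonpos_nonpos) auto
    then show ?thesis using key[of b] assms by (auto intro: min.coboundedI2)
  qed
qed

text \<open>The type \<open>'i\<close> indexes the family. All constants are fixed outside the
  quantifier over \<open>i\<close>, which is how the statement expresses uniformity in
  \<open>k\<close> and \<open>h\<close>.\<close>

theorem corollary2:
  fixes d :: nat and L :: "nat \<Rightarrow> real"
    and \<alpha> Cexc \<theta> C0 m_lo m_hi lam \<beta>0 q0 \<gamma>0 vartheta0 \<kappa>0 :: real
    and N :: "'i \<Rightarrow> nat \<Rightarrow> nat" and \<nu> :: "'i \<Rightarrow> nat \<Rightarrow> nat \<Rightarrow> nat"
    and F :: "'i \<Rightarrow> (nat \<Rightarrow> int) set"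
    and k :: "'i \<Rightarrow> real" and m :: "'i \<Rightarrow> nat \<Rightarrow> real^3"
  assumes "d \<in> {2, 3}" and "\<forall>l<d. L l > 0"
    and "\<alpha> > 0" and "Cexc > 0" and "\<theta> \<in> {1, 1/2}"
    and "\<forall>i. \<forall>l<d. N i l > 0"
    and "\<forall>i. node_numbering d (N i) (\<nu> i)"
    and "\<forall>i. aliasing_representatives d (N i) (F i)"
    and "\<forall>i. k i > 0"
    and "\<forall>i. k i / (mesh_width d L (N i))\<^sup>2 \<le> C0"
    and "0 < m_lo"
    and "\<forall>i. \<forall>p<grid_size d (N i). m_lo \<le> norm (m i p) \<and> norm (m i p) \<le> m_hi"
    and "lam > 0"
    and \<beta>0_def: "\<beta>0 = \<alpha> + \<theta> * Cexc * real d * pi\<^sup>2 * C0"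
    and q0_def: "q0 = max \<bar>(lam - \<alpha>) / (lam + \<alpha>)\<bar> \<bar>(lam - \<beta>0) / (lam + \<beta>0)\<bar>"
    and \<gamma>0_def: "\<gamma>0 = min (2 * lam * m_lo / (lam\<^sup>2 + m_lo\<^sup>2)) (2 * lam * m_hi / (lam\<^sup>2 + m_hi\<^sup>2))"
    and vartheta0_def: "vartheta0 = sqrt (1 - (1 - q0\<^sup>2) * \<gamma>0\<^sup>2 / (\<gamma>0\<^sup>2 + 1 + q0\<^sup>2))"
    and \<kappa>0_def: "\<kappa>0 = sqrt ((lam\<^sup>2 + m_hi\<^sup>2) / (lam\<^sup>2 + m_lo\<^sup>2))"
  shows "q0 < 1 \<and> \<gamma>0 > 0 \<and> vartheta0 < 1 \<and>
    (\<forall>i. let Ng = grid_size d (N i);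
             H = H_mat d L (N i) (\<nu> i) (F i) \<alpha> \<theta> (k i) Cexc;
             A = saddle_mat Ng H (m i);
             M = precond_mat Ng H (m i) lam
         in (\<forall>Z. orthonormal_kernel_basis Ng (B_mat Ng (m i)) Z \<longrightarrow> q_T H Z lam \<le> q0) \<and>
            (\<forall>b \<in> carrier_vec (4 * Ng). \<forall>x0 \<in> carrier_vec (4 * Ng). \<forall>x.
               (\<forall>j. gmres_iterate M A b x0 j (x j)) \<and>
               precond_residual M A b (x 0) \<noteq> 0\<^sub>v (4 * Ng) \<longrightarrow>
               (\<forall>j. vec_norm (precond_residual M A b (x (2 * j)))
                      / vec_norm (precond_residual M A b (x 0)) \<le> \<kappa>0 * vartheta0 ^ j) \<and>
               (\<forall>\<epsilon>. 0 < \<epsilon> \<and> \<epsilon> < 1 \<longrightarrow>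
                  (\<forall>n \<ge> 2 * nat \<lceil>ln (\<kappa>0 / \<epsilon>) / ln (1 / vartheta0)\<rceil>.
                     vec_norm (precond_residual M A b (x n))
                       / vec_norm (precond_residual M A b (x 0)) \<le> \<epsilon>))))"
proof -
  have d: "d > 0" and \<theta>: "\<theta> > 0"
    using assms(1,5) by auto
  have C0: "0 \<le> C0"
  proof -
    \<comment> \<open>Types are inhabited, so the family has a member, and its ratio
      \<open>k / h^2\<close> is nonnegative.\<close>
    have "0 \<le> k undefined / (mesh_width d L (N undefined))\<^sup>2"
      using assms(9) by (simp add: less_imp_le)
    then show ?thesis using assms(10) order_trans by blast
  qed
  have grid: "periodic_grid d L (N i) (\<nu> i) (F i)" for i
    using assms(2,6-8) by unfold_locales auto
  have m_le: "m_lo \<le> m_hi"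
    using assms(12) periodic_grid.n_pos[OF grid] order_trans by blast
  have \<alpha>\<beta>: "\<alpha> \<le> \<beta>0"
    unfolding \<beta>0_def using \<theta> assms(4) C0 by simp
  have "q0 < 1"
    unfolding q0_def using \<open>lam > 0\<close> \<open>\<alpha> > 0\<close> \<alpha>\<beta> by (auto simp: abs_if divide_simps)
  moreover have "0 \<le> q0"
    unfolding q0_def by (simp add: le_max_iff_disj)
  ultimately have q0: "0 \<le> q0" "q0 < 1" by simp_all
  then have q0_sq: "q0\<^sup>2 < 1"
    by (simp add: power2_less_1_iff abs_if)
  have \<gamma>0: "\<gamma>0 > 0"
    unfolding \<gamma>0_def using \<open>lam > 0\<close> \<open>0 < m_lo\<close> m_le by (simp add: add_pos_pos)
  define D where "D = \<gamma>0\<^sup>2 + 1 + q0\<^sup>2"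
  have D: "D > 0"
    by (simp add: D_def add_nonneg_pos add_pos_nonneg)
  have "0 < (1 - q0\<^sup>2) * \<gamma>0\<^sup>2 / D"
    using D \<gamma>0 q0_sq by simp
  \<comment> \<open>Strictness gives \<open>vartheta0 > 0\<close>, so that
    \<open>1 / vartheta0\<close> is a genuine reciprocal in the iteration count.\<close>
  moreover have "(1 - q0\<^sup>2) * \<gamma>0\<^sup>2 / D < 1"
  proof -
    have "(1 - q0\<^sup>2) * \<gamma>0\<^sup>2 \<le> 1 * \<gamma>0\<^sup>2"
      by (intro mult_right_mono) auto
    also have "\<dots> < D"
      unfolding D_def by (simp add: add_pos_nonneg)
    finally show ?thesis using D by simp
  qed
  ultimately have vartheta0: "0 < vartheta0" "vartheta0 < 1"
    unfolding vartheta0_def D_def[symmetric] by simp_all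
  have \<kappa>0: "1 \<le> \<kappa>0"
    unfolding \<kappa>0_def using \<open>lam > 0\<close> \<open>0 < m_lo\<close> m_le by (simp add: add_pos_pos power_mono)
  have bounds: "\<alpha> \<le> \<alpha> + \<theta> * k i * Cexc * periodic_grid.symb d L \<kappa> \<and>
      \<alpha> + \<theta> * k i * Cexc * periodic_grid.symb d L \<kappa> \<le> \<beta>0" if \<kappa>: "\<kappa> \<in> F i" for i \<kappa>
  proof -
    interpret periodic_grid d L "N i" "\<nu> i" "F i" by (rule grid)
    have ki: "k i > 0" using assms(9) by simp
    \<comment> \<open>The grid and the time step enter the symbol bound only through
      \<open>k / h^2\<close>, which the assumption replaces by \<open>C0\<close>.\<close>
    have "k i * symb \<kappa> \<le> k i * (real d * pi\<^sup>2 / (mesh_width d L (N i))\<^sup>2)"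
      using symb_le[OF \<kappa> d] ki by (intro mult_left_mono) auto
    also have "\<dots> = k i / (mesh_width d L (N i))\<^sup>2 * (real d * pi\<^sup>2)" by simp
    also have "\<dots> \<le> C0 * (real d * pi\<^sup>2)"
      using assms(10) by (intro mult_right_mono) auto
    finally have "\<theta> * Cexc * (k i * symb \<kappa>) \<le> \<theta> * Cexc * (C0 * (real d * pi\<^sup>2))"
      using \<theta> assms(4) by (intro mult_left_mono) auto
    moreover have "0 \<le> \<theta> * k i * Cexc * symb \<kappa>"
      using \<theta> assms(4) ki symb_nonneg by simp
    ultimately show ?thesis
      unfolding \<beta>0_def by (simp add: mult_ac)
  qed
  have cayley: "0 < lam + (\<alpha> + \<theta> * k i * Cexc * periodic_grid.symb d L \<kappa>)"
    "\<bar>lam - (\<alpha> + \<theta> * k i * Cexc * periodic_grid.symb d L \<kappa>)\<bar>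
      \<le> q0 * (lam + (\<alpha> + \<theta> * k i * Cexc * periodic_grid.symb d L \<kappa>))" if "\<kappa> \<in> F i" for i \<kappa>
    using bounds[OF that] \<open>lam > 0\<close> \<open>\<alpha> > 0\<close>
    unfolding q0_def by (linarith, intro cayley_bound, auto)
  have member: "let Ng = grid_size d (N i);
             H = H_mat d L (N i) (\<nu> i) (F i) \<alpha> \<theta> (k i) Cexc;
             A = saddle_mat Ng H (m i);
             M = precond_mat Ng H (m i) lam
         in (\<forall>Z. orthonormal_kernel_basis Ng (B_mat Ng (m i)) Z \<longrightarrow> q_T H Z lam \<le> q0) \<and>
            (\<forall>b \<in> carrier_vec (4 * Ng). \<forall>x0 \<in> carrier_vec (4 * Ng). \<forall>x.
               (\<forall>j. gmres_iterate M A b x0 j (x j)) \<and>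
               precond_residual M A b (x 0) \<noteq> 0\<^sub>v (4 * Ng) \<longrightarrow>
               (\<forall>j. vec_norm (precond_residual M A b (x (2 * j)))
                      / vec_norm (precond_residual M A b (x 0)) \<le> \<kappa>0 * vartheta0 ^ j) \<and>
               (\<forall>\<epsilon>. 0 < \<epsilon> \<and> \<epsilon> < 1 \<longrightarrow>
                  (\<forall>n \<ge> 2 * nat \<lceil>ln (\<kappa>0 / \<epsilon>) / ln (1 / vartheta0)\<rceil>.
                     vec_norm (precond_residual M A b (x n))
                       / vec_norm (precond_residual M A b (x 0)) \<le> \<epsilon>)))" for i
  proof -
    interpret periodic_grid d L "N i" "\<nu> i" "F i" by (rule grid)
    define Ng where "Ng = grid_size d (N i)"
    define H where "H = H_mat d L (N i) (\<nu> i) (F i) \<alpha> \<theta> (k i) Cexc"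
    define A where "A = saddle_mat Ng H (m i)"
    define M where "M = precond_mat Ng H (m i) lam"
    note defs = Ng_def H_def A_def M_def
    have qT: "q_T H Z lam \<le> q0" if "orthonormal_kernel_basis Ng (B_mat Ng (m i)) Z" for Z
      unfolding q0_def H_def
      using bounds that \<open>lam > 0\<close> \<open>\<alpha> > 0\<close> unfolding Ng_def by (rule q_T_le)
    have A: "A \<in> carrier_mat (4 * Ng) (4 * Ng)" and Mi: "mat_inv M \<in> carrier_mat (4 * Ng) (4 * Ng)"
      unfolding defs
      by (rule A_carrier[OF \<open>lam > 0\<close> cayley] mat_inv_M(1)[OF \<open>lam > 0\<close> cayley]; assumption)+
    \<comment> \<open>Allowing every \<open>n\<close> from \<open>2 * j\<close> on covers both the
      even iterates and all iterates beyond the claimed count.\<close>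
    have residual: "vec_norm (precond_residual M A b (x n)) / vec_norm (precond_residual M A b (x 0))
        \<le> \<kappa>0 * vartheta0 ^ j"
      if b: "b \<in> carrier_vec (4 * Ng)" and x0: "x0 \<in> carrier_vec (4 * Ng)"
        and x: "\<forall>j. gmres_iterate M A b x0 j (x j)"
        and nz: "precond_residual M A b (x 0) \<noteq> 0\<^sub>v (4 * Ng)" and n: "2 * j \<le> n"
      for b x0 x n j
    proof -
      let ?r = "precond_residual M A b x0"
      have r: "?r \<in> carrier_vec (4 * Ng)"
        unfolding precond_residual_def using Mi by (rule mult_mat_vec_carrier) (use b mult_mat_vec_carrier[OF A x0] in auto)
      have "x 0 = x0" using x gmres_iterate_0[OF Mi A b x0] by blast
      with nz have r0: "?r \<noteq> 0\<^sub>v (4 * Ng)" by simp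
      then have pos: "vec_norm ?r > 0"
        using vec_norm_eq_0_iff[OF r] vec_norm_nonneg[of ?r] by linarith
      have "vec_norm (precond_residual M A b (x n))
          \<le> vec_norm ((richardson (mat_inv M * A) (2 * lam) ^^ (2 * j)) ?r)"
        using x n by (intro gmres_residual_le[OF Mi A b x0]) auto
      also have "\<dots> \<le> \<kappa>0 * vartheta0 ^ j * vec_norm ?r"
        unfolding \<kappa>0_def vartheta0_def defs
      proof (rule richardson_bound[OF \<open>lam > 0\<close> cayley _ q0 \<gamma>0])
        fix p assume "p < grid_size d (N i)"
        then show "\<gamma>0 \<le> 2 * lam * norm (m i p) / (lam\<^sup>2 + (norm (m i p))\<^sup>2)"
          unfolding \<gamma>0_def using assms(12) \<open>0 < m_lo\<close> by (intro coupling_ge_min[OF \<open>lam > 0\<close>]) auto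
      qed (use assms(11,12) r in \<open>auto simp: defs\<close>)
      finally show ?thesis
        using pos \<open>x 0 = x0\<close> by (simp add: pos_divide_le_eq)
    qed
    have iterations: "\<kappa>0 * vartheta0 ^ nat \<lceil>ln (\<kappa>0 / \<epsilon>) / ln (1 / vartheta0)\<rceil> \<le> \<epsilon>"
      if \<epsilon>: "0 < \<epsilon>" for \<epsilon>
    proof -
      define j where "j = nat \<lceil>ln (\<kappa>0 / \<epsilon>) / ln (1 / vartheta0)\<rceil>"
      have l: "0 < ln (1 / vartheta0)" using vartheta0 by (intro ln_gt_zero) simp
      \<comment> \<open>Should the ceiling be negative, \<open>nat\<close> only enlarges it, so the
        inequality still holds.\<close>
      have "ln (\<kappa>0 / \<epsilon>) / ln (1 / vartheta0) \<le> real j" unfolding j_def by linarith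
      then have "ln (\<kappa>0 / \<epsilon>) \<le> real j * ln (1 / vartheta0)" using l by (simp add: pos_divide_le_eq)
      also have "\<dots> = ln ((1 / vartheta0) ^ j)" using vartheta0 by (simp add: ln_realpow)
      finally have "\<kappa>0 / \<epsilon> \<le> (1 / vartheta0) ^ j"
        using \<kappa>0 \<epsilon> vartheta0 by (subst (asm) ln_le_cancel_iff) auto
      then show ?thesis
        unfolding j_def[symmetric] using \<epsilon> vartheta0 by (simp add: field_simps)
    qed
    show ?thesis
      unfolding Let_def Ng_def[symmetric] unfolding H_def[symmetric]
      unfolding A_def[symmetric] M_def[symmetric]
      using qT residual order_trans[OF residual iterations] by blast
  qed
  show ?thesis
    using q0 \<gamma>0 vartheta0 member by blast
qed

end
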